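(* Consider the progressive-precision $V(1,0)$-cycle on a hierarchy of levels $j=1,\dots,\ell$, with the assumptions, parameters and rounding error model given in the context, applied to $Ay=r$ on the finest level $\ell$ (where $A=A_\ell$) with zero initial guess. If, for every $1\le j\le\ell$, $\dot\tau_j$ is small enough that $$\delta_{\rho_v}(\dot\tau_j)=\frac{\vartheta^m}{\vartheta^m-1}\,\delta_{\rho_{tg}}(\dot\tau_j)<1-\rho_v^*,$$ then the result $y$ of one cycle satisfies $$\|y-A^{-1}r\|_A\le\rho_v\,\|A^{-1}r\|_A,\qquad \rho_v=\rho_v^*+\delta_{\rho_v},\qquad \delta_{\rho_v}=\delta_{\rho_v}(\dot\tau_\ell)=\frac{\vartheta^m}{\vartheta^m-1}\,\delta_{\rho_{tg}}(\dot\tau_\ell).$$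
   Context: Norms: $\|\cdot\|$ is the Euclidean vector norm and its induced matrix norm; for an SPD matrix $S$, $\|x\|_S=\|S^{1/2}x\|$, with induced matrix norm also written $\|\cdot\|_S$. $|\cdot|$ is entrywise and vector inequalities are entrywise. $\kappa(\cdot)$ is the Euclidean-norm condition number. Hierarchy: $\ell\ge2$; for $1\le j\le\ell$, $A_j$ is an SPD matrix with at most $m_{A_j}$ nonzeros per row, $A_\ell=A$. For $2\le j\le\ell$, $P_j$ is the interpolation matrix from level $j-1$ to level $j$, of full column rank with at most $m_{P_j}$ nonzeros per row or column, all positive, and $A_{j-1}=P_j^tA_jP_j$ exactly. $M_j$ is nonsingular, $G_j=I_j-M_jA_j$, and $\|G_j\|_{A_j}<1$. Put $T_j=I_j-P_jA_{j-1}^{-1}P_j^tA_j$, $V_1=G_1$ and $V_j=(P_jV_{j-1}A_{j-1}^{-1}P_j^tA_j+T_j)G_j$ for $2\le j\le\ell$. Assume $\rho_v^*\in[0,1)$ satisfies $\|V_j\|_{A_j}\le\rho_v^*$ for $1\le j\le\ell$. All matrices are exact. Precisions and scales: $\dot\varepsilon_j\in(0,1)$ is the unit roundoff on level $j$; $\dot\zeta_j=\dot\varepsilon_{j-1}/\dot\varepsilon_j\ge1$ for $2\le j\le\ell$ and $\dot\zeta=\max_{2\le j\le\ell}\dot\zeta_j$. $m$ is a positive integer, $h_j=\kappa^{-1/(2m)}(A_j)$, $\theta_j=h_{j-1}/h_j$ for $2\le j\le\ell$, and $\vartheta=\min_{2\le j\le\ell}\theta_j\dot\zeta_j^{-1/m}$,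 assumed to satisfy $\vartheta>1$. $\dot\tau_j=\kappa^{1/2}(A_j)\dot\varepsilon_j$. Parameters: $\kappa(P^tP)=\max_{2\le j\le\ell}\kappa(P_j^tP_j)$, $\dot m_P^+=\max_{2\le j\le\ell}\dfrac{m_{P_j}}{1-m_{P_j}\dot\varepsilon_j}$, $\dot m_A^+=\max_{1\le j\le\ell}\dfrac{m_{A_j}+1}{1-(m_{A_j}+1)\dot\varepsilon_j}$ (all denominators positive). $\alpha_{M_j}$ is a constant such that computing $M_jz$ in $\dot\varepsilon_j$-precision gives $M_jz+\delta$ with $\|\delta\|\le\alpha_{M_j}\dot\varepsilon_j\|z\|$ for every $z$. $\sigma$ is a constant such that $\sigma\ge(1+\dot\varepsilon_j)\max\{\alpha_{M_j}\|A_j\|,\ \alpha_{M_j}\|\,|A_j|\,\|,\ \|\,|A_j|\,\|\,\|M_j\|\}$ for all $1\le j\le\ell$. With $\beta=2+3\sigma+2\dot m_A^+(1+\sigma)$ and $\dot\mu(t)=3\,\dot\zeta\,\kappa^{1/2}(P^tP)\,\dot m_P^+\,t$, define $$\delta_{\rho_{tg}}(t)=4t+(2+\beta)\dot\mu(t)+2t^2+(4+\beta)\dot\mu(t)\,t+2\dot\mu(t)\,t^2 .$$ Cycle with rounding error model. On level $j$ with right-hand side $r_j$ ($r_\ell=r$), the output $y_j$ is computed as follows: (1) round: $r_j^{(0)}=r_j+\delta_0$, $\|\delta_0\|\le\dot\varepsilon_j\|r_j\|$; (2) relax from zero: $y_j^{(1/2)}=M_jr_j^{(0)}+\delta$, $\|\delta\|\le\alpha_{M_j}\dot\varepsilon_j\|r_j^{(0)}\|$;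 if $j=1$, return $y_1=y_1^{(1/2)}$; (3) residual: $s_j=A_jy_j^{(1/2)}-r_j^{(0)}+\delta$, $|\delta|\le\dot m_A^+\dot\varepsilon_j\,(|r_j^{(0)}|+|A_j|\,|y_j^{(1/2)}|)$; (4) restriction: $r_{j-1}=P_j^ts_j+\delta$, $|\delta|\le(\dot\varepsilon_{j-1}+(1+\dot\varepsilon_{j-1})\dot m_P^+\dot\varepsilon_j)\,P_j^t|s_j|$; (5) $d_{j-1}$ is the output of the same cycle on level $j-1$ with right-hand side $r_{j-1}$; (6) interpolation: $d_j=P_jd_{j-1}+\delta$, $|\delta|\le\dot m_P^+\dot\varepsilon_{j-1}\,P_j|d_{j-1}|$; (7) update: each component of $y_j$ is the corresponding component of $y_j^{(1/2)}-d_j$ times a factor $1+\delta$ with $|\delta|\le\dot\varepsilon_j$. The final result is $y=y_\ell$. *)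

theory Defs
  imports
    Complex_Main
    "Jordan_Normal_Form.Gauss_Jordan_Elimination"
    "Jordan_Normal_Form.DL_Rank"
begin

text \<open>Matrix inverse; meaningful only for nonsingular square arguments.\<close>
definition inv_mat :: "real mat \<Rightarrow> real mat" where
  "inv_mat B = the (mat_inverse B)"

definition spd_mat :: "real mat \<Rightarrow> bool" where
  "spd_mat S \<longleftrightarrow> square_mat S \<and> transpose_mat S = S \<and>
     (\<forall>x \<in> carrier_vec (dim_row S). x \<noteq> 0\<^sub>v (dim_row S) \<longrightarrow> x \<bullet> (S *\<^sub>v x) > 0)"

text \<open>For SPD \<open>S\<close> there is exactly one SPD matrix whose square is \<open>S\<close>, so the choice
  operator selects the usual \<open>S\<^sup>1\<^sup>/\<^sup>2\<close>.\<close>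
definition sqrt_mat :: "real mat \<Rightarrow> real mat" where
  "sqrt_mat S = (SOME R. spd_mat R \<and> R * R = S)"

definition vnorm :: "real vec \<Rightarrow> real" where
  "vnorm x = sqrt (x \<bullet> x)"

definition energy_norm :: "real mat \<Rightarrow> real vec \<Rightarrow> real" where
  "energy_norm S x = vnorm (sqrt_mat S *\<^sub>v x)"

text \<open>Induced matrix norms, for matrices with at least one column (otherwise the supremum is
  over the empty set).\<close>
definition mat_norm :: "real mat \<Rightarrow> real" where
  "mat_norm B = (SUP x \<in> carrier_vec (dim_col B) - {0\<^sub>v (dim_col B)}. vnorm (B *\<^sub>v x) / vnorm x)"

definition energy_mat_norm :: "real mat \<Rightarrow> real mat \<Rightarrow> real" where
  "energy_mat_norm S B =
     (SUP x \<in> carrier_vec (dim_col B) - {0\<^sub>v (dim_col B)}. energy_norm S (B *\<^sub>v x) / energy_norm S x)"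

definition cond_num :: "real mat \<Rightarrow> real" where
  "cond_num B = mat_norm B * mat_norm (inv_mat B)"

definition abs_mat :: "real mat \<Rightarrow> real mat" where
  "abs_mat B = map_mat abs B"

definition abs_vec :: "real vec \<Rightarrow> real vec" where
  "abs_vec x = map_vec abs x"

definition row_nonzeros_le :: "real mat \<Rightarrow> nat \<Rightarrow> bool" where
  "row_nonzeros_le B k \<longleftrightarrow> (\<forall>i < dim_row B. card {c. c < dim_col B \<and> B $$ (i, c) \<noteq> 0} \<le> k)"

definition col_nonzeros_le :: "real mat \<Rightarrow> nat \<Rightarrow> bool" where
  "col_nonzeros_le B k \<longleftrightarrow> (\<forall>c < dim_col B. card {i. i < dim_row B \<and> B $$ (i, c) \<noteq> 0} \<le> k)"

text \<open>Families indexed by the level \<open>j\<close> are functions on \<open>nat\<close>; only the values at levels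
  \<open>1, \<dots>, l\<close> (for \<open>P\<close> and for quantities relating two levels: \<open>2, \<dots>, l\<close>) matter.\<close>

definition relax_err :: "(nat \<Rightarrow> real mat) \<Rightarrow> (nat \<Rightarrow> real mat) \<Rightarrow> nat \<Rightarrow> real mat" where
  "relax_err A M j = 1\<^sub>m (dim_row (A j)) - M j * A j"

definition coarse_corr_err :: "(nat \<Rightarrow> real mat) \<Rightarrow> (nat \<Rightarrow> real mat) \<Rightarrow> nat \<Rightarrow> real mat" where
  "coarse_corr_err A P j =
     1\<^sub>m (dim_row (A j)) - P j * inv_mat (A (j - 1)) * transpose_mat (P j) * A j"

text \<open>The matrices \<open>V\<^sub>j\<close>; the value at \<open>j = 0\<close> is unspecified.\<close>
fun vcycle_err ::
  "(nat \<Rightarrow> real mat) \<Rightarrow> (nat \<Rightarrow> real mat) \<Rightarrow> (nat \<Rightarrow> real mat) \<Rightarrow> nat \<Rightarrow> real mat" where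
  "vcycle_err A P M (Suc 0) = relax_err A M (Suc 0)"
| "vcycle_err A P M (Suc (Suc k)) =
     (let j = Suc (Suc k) in
       (P j * vcycle_err A P M (Suc k) * inv_mat (A (Suc k)) * transpose_mat (P j) * A j
          + coarse_corr_err A P j) * relax_err A M j)"

definition zeta_lev :: "(nat \<Rightarrow> real) \<Rightarrow> nat \<Rightarrow> real" where
  "zeta_lev eps j = eps (j - 1) / eps j"

definition zeta_max :: "nat \<Rightarrow> (nat \<Rightarrow> real) \<Rightarrow> real" where
  "zeta_max l eps = (MAX j \<in> {2..l}. zeta_lev eps j)"

text \<open>In the next definitions \<open>m\<close> is the positive integer with \<open>h\<^sub>j = \<kappa>(A\<^sub>j)\<close> to the power
  \<open>- 1 / (2 m)\<close>.\<close>
definition mesh_size :: "nat \<Rightarrow> (nat \<Rightarrow> real mat) \<Rightarrow> nat \<Rightarrow> real" where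
  "mesh_size m A j = cond_num (A j) powr (- 1 / (2 * real m))"

definition theta_lev :: "nat \<Rightarrow> (nat \<Rightarrow> real mat) \<Rightarrow> nat \<Rightarrow> real" where
  "theta_lev m A j = mesh_size m A (j - 1) / mesh_size m A j"

definition vartheta :: "nat \<Rightarrow> nat \<Rightarrow> (nat \<Rightarrow> real mat) \<Rightarrow> (nat \<Rightarrow> real) \<Rightarrow> real" where
  "vartheta l m A eps = (MIN j \<in> {2..l}. theta_lev m A j * zeta_lev eps j powr (- 1 / real m))"

definition tau :: "(nat \<Rightarrow> real mat) \<Rightarrow> (nat \<Rightarrow> real) \<Rightarrow> nat \<Rightarrow> real" where
  "tau A eps j = sqrt (cond_num (A j)) * eps j"

definition cond_PtP :: "nat \<Rightarrow> (nat \<Rightarrow> real mat) \<Rightarrow> real" where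
  "cond_PtP l P = (MAX j \<in> {2..l}. cond_num (transpose_mat (P j) * P j))"

definition mP_plus :: "nat \<Rightarrow> (nat \<Rightarrow> nat) \<Rightarrow> (nat \<Rightarrow> real) \<Rightarrow> real" where
  "mP_plus l mP eps = (MAX j \<in> {2..l}. real (mP j) / (1 - real (mP j) * eps j))"

definition mA_plus :: "nat \<Rightarrow> (nat \<Rightarrow> nat) \<Rightarrow> (nat \<Rightarrow> real) \<Rightarrow> real" where
  "mA_plus l mA eps = (MAX j \<in> {1..l}. (real (mA j) + 1) / (1 - (real (mA j) + 1) * eps j))"

definition beta :: "real \<Rightarrow> real \<Rightarrow> real" where
  "beta \<sigma> mAp = 2 + 3 * \<sigma> + 2 * mAp * (1 + \<sigma>)"

definition mu :: "real \<Rightarrow> real \<Rightarrow> real \<Rightarrow> real \<Rightarrow> real" where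
  "mu \<zeta> \<kappa>P mPp t = 3 * \<zeta> * sqrt \<kappa>P * mPp * t"

definition delta_rho_tg ::
  "nat \<Rightarrow> (nat \<Rightarrow> real mat) \<Rightarrow> (nat \<Rightarrow> nat) \<Rightarrow> (nat \<Rightarrow> nat) \<Rightarrow> (nat \<Rightarrow> real) \<Rightarrow> real \<Rightarrow> real \<Rightarrow> real" where
  "delta_rho_tg l P mA mP eps \<sigma> t =
     (let b = beta \<sigma> (mA_plus l mA eps);
          u = mu (zeta_max l eps) (cond_PtP l P) (mP_plus l mP eps) t
      in 4 * t + (2 + b) * u + 2 * t^2 + (4 + b) * u * t + 2 * u * t^2)"

definition delta_rho_v ::
  "nat \<Rightarrow> nat \<Rightarrow> (nat \<Rightarrow> real mat) \<Rightarrow> (nat \<Rightarrow> real mat) \<Rightarrow> (nat \<Rightarrow> nat) \<Rightarrow> (nat \<Rightarrow> nat) \<Rightarrow>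
   (nat \<Rightarrow> real) \<Rightarrow> real \<Rightarrow> real \<Rightarrow> real" where
  "delta_rho_v l m A P mA mP eps \<sigma> t =
     vartheta l m A eps ^ m / (vartheta l m A eps ^ m - 1) * delta_rho_tg l P mA mP eps \<sigma> t"

text \<open>\<open>rounded_cycle A P M eps \<alpha> mAp mPp j r y\<close>: under the rounding error model, \<open>y\<close> is a possible
  result of one \<open>V(1,0)\<close>-cycle with zero initial guess on level \<open>j\<close> for the right-hand side \<open>r\<close>.
  The vectors \<open>e0, e1, \<dots>\<close> are the rounding errors of the successive steps. The order on vectors
  is the entrywise one and includes equality of dimensions.\<close>
inductive rounded_cycle ::
  "(nat \<Rightarrow> real mat) \<Rightarrow> (nat \<Rightarrow> real mat) \<Rightarrow> (nat \<Rightarrow> real mat) \<Rightarrow> (nat \<Rightarrow> real) \<Rightarrow> (nat \<Rightarrow> real) \<Rightarrow>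
   real \<Rightarrow> real \<Rightarrow> nat \<Rightarrow> real vec \<Rightarrow> real vec \<Rightarrow> bool"
  for A P M eps \<alpha> mAp mPp where
  coarsest:
  "\<lbrakk> r \<in> carrier_vec (dim_row (A 1));
     e0 \<in> carrier_vec (dim_row (A 1)); vnorm e0 \<le> eps 1 * vnorm r;
     r0 = r + e0;
     e1 \<in> carrier_vec (dim_row (A 1)); vnorm e1 \<le> \<alpha> 1 * eps 1 * vnorm r0;
     y = M 1 *\<^sub>v r0 + e1 \<rbrakk>
   \<Longrightarrow> rounded_cycle A P M eps \<alpha> mAp mPp 1 r y"
| finer:
  "\<lbrakk> 2 \<le> j;
     r \<in> carrier_vec (dim_row (A j));
     e0 \<in> carrier_vec (dim_row (A j)); vnorm e0 \<le> eps j * vnorm r;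
     r0 = r + e0;
     e1 \<in> carrier_vec (dim_row (A j)); vnorm e1 \<le> \<alpha> j * eps j * vnorm r0;
     y_half = M j *\<^sub>v r0 + e1;
     abs_vec e2 \<le> (mAp * eps j) \<cdot>\<^sub>v (abs_vec r0 + abs_mat (A j) *\<^sub>v abs_vec y_half);
     s = A j *\<^sub>v y_half - r0 + e2;
     abs_vec e3 \<le> (eps (j - 1) + (1 + eps (j - 1)) * mPp * eps j) \<cdot>\<^sub>v
                     (transpose_mat (P j) *\<^sub>v abs_vec s);
     rc = transpose_mat (P j) *\<^sub>v s + e3;
     rounded_cycle A P M eps \<alpha> mAp mPp (j - 1) rc dc;
     abs_vec e4 \<le> (mPp * eps (j - 1)) \<cdot>\<^sub>v (P j *\<^sub>v abs_vec dc);
     d = P j *\<^sub>v dc + e4;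
     \<forall>i < dim_row (A j). \<bar>e5 $ i\<bar> \<le> eps j;
     y = vec (dim_row (A j)) (\<lambda>i. (y_half $ i - d $ i) * (1 + e5 $ i)) \<rbrakk>
   \<Longrightarrow> rounded_cycle A P M eps \<alpha> mAp mPp j r y"

end

theory Submission
  imports Defs "HOL-Analysis.L2_Norm" "Jordan_Normal_Form.Spectral_Radius"
begin

text \<open>Let \<open>x = A\<^sub>j\<^sup>-\<^sup>1 r\<close>. The exact cycle on level \<open>j\<close> returns \<open>x - V\<^sub>j x\<close>, and the induction over the levels
  compares the computed \<open>y\<close> with this vector rather than with \<open>x\<close>: the energy norm of
  \<open>y - (x - V\<^sub>j x)\<close> is at most \<open>\<delta>\<^sub>j\<close> times that of \<open>x\<close>, where \<open>\<delta>\<^sub>j\<close> is \<open>\<delta>\<^sub>\<rho>\<^sub>v\<close> at \<open>\<tau>\<^sub>j\<close>. Passing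
  the rounding errors of one level through the exact linear operators shows that they add
  \<open>\<delta>\<^sub>\<rho>\<^sub>t\<^sub>g\<close> at \<open>\<tau>\<^sub>j\<close> to the inherited \<open>\<delta>\<^sub>j\<^sub>-\<^sub>1\<close>; the products of \<open>\<delta>\<^sub>j\<^sub>-\<^sub>1\<close> with the local errors are
  absorbed because \<open>\<rho>\<^sub>v\<^sup>* + \<delta>\<^sub>j\<^sub>-\<^sub>1 \<le> 1\<close>. Since \<open>\<tau>\<^sub>j\<^sub>-\<^sub>1\<close> is at most \<open>\<tau>\<^sub>j\<close> divided by the \<open>m\<close>-th power of \<open>\<vartheta>\<close>, the
  contributions of the levels form a geometric series.\<close>

section \<open>Vector norm and inverses\<close>

text \<open>The comparison vector is forced by the hypotheses: \<open>\<rho>_star\<close> bounds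
  exact operators only, and a contraction bound for the computed coarse cycle says nothing about the
  norm of \<open>V\<^sub>j\<close>. Staying close to the exact cycle lets the hypothesis on
  \<open>V\<^sub>j\<close> be used afresh on every level. Rounding errors in a right-hand side or
  residual are pulled back by the inverse matrix, so that all errors are measured in the energy
  norm. Each conversion between Euclidean and energy norm costs the square root of a matrix norm,
  which is why \<tau> carries only the square root of the condition number. The Galerkin relation
  makes interpolation an isometry of energy norms, so the inherited error reaches the finer level
  without such a factor. The smallness assumption enters a second time as \<mu> (2 + \<beta>) \<le>
  1, which pays for products of local errors. With F the m-th power of \<vartheta>, the factor D = F
  / (F - 1) is the solution of D = D / F + 1: inherited part plus one level.\<close>

lemma vnorm_L2_set: "vnorm x = L2_set (\<lambda>i. x $ i) {0..<dim_vec x}"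
  by (simp add: vnorm_def L2_set_def scalar_prod_def power2_eq_square)

lemma vnorm_nonneg [simp]: "0 \<le> vnorm x"
  by (simp add: vnorm_L2_set)

lemma scalar_prod_self_eq_vnorm: "x \<bullet> x = (vnorm x)\<^sup>2"
  by (simp add: vnorm_def scalar_prod_def sum_nonneg)

lemma vnorm_zero [simp]: "vnorm (0\<^sub>v n) = 0"
  by (simp add: vnorm_def)

lemma vnorm_eq_0_iff:
  assumes "x \<in> carrier_vec n"
  shows "vnorm x = 0 \<longleftrightarrow> x = 0\<^sub>v n"
proof
  assume "vnorm x = 0"
  then have "\<forall>i\<in>{0..<n}. x $ i = 0"
    using assms by (simp add: vnorm_L2_set L2_set_eq_0_iff)
  then show "x = 0\<^sub>v n" using assms by (intro eq_vecI) auto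
qed simp

lemma vnorm_pos_iff: "x \<in> carrier_vec n \<Longrightarrow> 0 < vnorm x \<longleftrightarrow> x \<noteq> 0\<^sub>v n"
  using vnorm_eq_0_iff[of x n] vnorm_nonneg[of x] by linarith

lemma abs_scalar_prod_le:
  assumes "x \<in> carrier_vec n" "y \<in> carrier_vec n"
  shows "\<bar>x \<bullet> y\<bar> \<le> vnorm x * vnorm y"
proof -
  have "\<bar>x \<bullet> y\<bar> \<le> (\<Sum>i\<in>{0..<n}. \<bar>x $ i\<bar> * \<bar>y $ i\<bar>)"
    using assms unfolding scalar_prod_def by (auto intro!: order_trans[OF sum_abs] simp: abs_mult)
  also have "\<dots> \<le> vnorm x * vnorm y"
    using assms L2_set_mult_ineq[of "\<lambda>i. x $ i" "\<lambda>i. y $ i" "{0..<n}"] by (simp add: vnorm_L2_set)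
  finally show ?thesis .
qed

lemma vnorm_triangle:
  assumes "x \<in> carrier_vec n" "y \<in> carrier_vec n"
  shows "vnorm (x + y) \<le> vnorm x + vnorm y"
proof -
  have "vnorm (x + y) = L2_set (\<lambda>i. x $ i + y $ i) {0..<n}"
    unfolding vnorm_L2_set using assms by (auto intro!: L2_set_cong)
  then show ?thesis
    using assms L2_set_triangle_ineq[of "\<lambda>i. x $ i" "\<lambda>i. y $ i" "{0..<n}"]
    by (simp add: vnorm_L2_set)
qed

lemma vnorm_smult: "vnorm (c \<cdot>\<^sub>v x) = \<bar>c\<bar> * vnorm x"
proof -
  have "(c \<cdot>\<^sub>v x) \<bullet> (c \<cdot>\<^sub>v x) = c\<^sup>2 * (x \<bullet> x)"
    by (simp add: scalar_prod_def sum_distrib_left power2_eq_square algebra_simps)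
  then show ?thesis by (simp add: vnorm_def real_sqrt_mult)
qed

lemma vnorm_le_cmult:
  assumes "dim_vec x = dim_vec y" "0 \<le> c" "\<And>i. i < dim_vec y \<Longrightarrow> \<bar>x $ i\<bar> \<le> c * \<bar>y $ i\<bar>"
  shows "vnorm x \<le> c * vnorm y"
proof -
  have "vnorm x = L2_set (\<lambda>i. \<bar>x $ i\<bar>) {0..<dim_vec y}"
    using assms by (simp add: vnorm_L2_set L2_set_def)
  also have "\<dots> \<le> L2_set (\<lambda>i. c * \<bar>y $ i\<bar>) {0..<dim_vec y}"
    using assms by (intro L2_set_mono) auto
  also have "\<dots> = c * vnorm y"
    using assms
    by (simp add: vnorm_L2_set L2_set_right_distrib) (simp add: L2_set_def power_mult_distrib)
  finally show ?thesis .
qed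

lemma abs_vec_dim [simp]: "dim_vec (abs_vec x) = dim_vec x"
  by (simp add: abs_vec_def)

lemma abs_vec_index [simp]: "i < dim_vec x \<Longrightarrow> abs_vec x $ i = \<bar>x $ i\<bar>"
  by (simp add: abs_vec_def)

lemma abs_vec_carrier [simp]: "abs_vec x \<in> carrier_vec n \<longleftrightarrow> x \<in> carrier_vec n"
  unfolding carrier_vec_def mem_Collect_eq abs_vec_dim ..

lemma vnorm_abs_vec [simp]: "vnorm (abs_vec x) = vnorm x"
  by (simp add: vnorm_L2_set L2_set_def)

text \<open>The entrywise order on vectors includes equality of dimensions.\<close>
lemma abs_vec_le_smultD:
  assumes "abs_vec x \<le> c \<cdot>\<^sub>v y" "y \<in> carrier_vec n" "0 \<le> c"
  shows "x \<in> carrier_vec n" "vnorm x \<le> c * vnorm y"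
proof -
  have *: "dim_vec x = dim_vec y" "\<And>i. i < dim_vec y \<Longrightarrow> \<bar>x $ i\<bar> \<le> c * y $ i"
    using assms(1) by (auto simp: less_eq_vec_def)
  show "x \<in> carrier_vec n" using * assms(2) by auto
  show "vnorm x \<le> c * vnorm y"
    using * assms(3) by (intro vnorm_le_cmult) (auto intro: order_trans[OF _ mult_left_mono[OF abs_ge_self]])
qed

text \<open>A real \<open>SUP\<close> is an upper bound only for a bounded set. The Frobenius norm,
  obtained by Cauchy-Schwarz in every row, supplies the finite bound that makes
  \<open>mat_norm\<close> usable.\<close>

lemma vnorm_mult_mat_vec_frobenius:
  assumes B: "B \<in> carrier_mat k n" and x: "x \<in> carrier_vec n"
  shows "vnorm (B *\<^sub>v x) \<le> L2_set (\<lambda>i. vnorm (row B i)) {0..<k} * vnorm x"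
proof -
  have "vnorm (B *\<^sub>v x) = L2_set (\<lambda>i. \<bar>(B *\<^sub>v x) $ i\<bar>) {0..<k}"
    using B by (auto simp: vnorm_L2_set L2_set_def)
  also have "\<dots> \<le> L2_set (\<lambda>i. vnorm (row B i) * vnorm x) {0..<k}"
    using B x by (intro L2_set_mono) (auto intro!: abs_scalar_prod_le)
  also have "\<dots> = L2_set (\<lambda>i. vnorm (row B i)) {0..<k} * vnorm x"
    by (simp add: L2_set_left_distrib)
  finally show ?thesis .
qed

lemma vnorm_mult_mat_vec_le:
  assumes B: "B \<in> carrier_mat k n" and x: "x \<in> carrier_vec n"
  shows "vnorm (B *\<^sub>v x) \<le> mat_norm B * vnorm x"
proof (cases "x = 0\<^sub>v n")
  case True
  with B have "B *\<^sub>v x = 0\<^sub>v k" by auto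
  then show ?thesis using True by simp
next
  case False
  then have pos: "0 < vnorm x" using x vnorm_pos_iff by blast
  let ?S = "carrier_vec (dim_col B) - {0\<^sub>v (dim_col B)} :: real vec set"
  have "bdd_above ((\<lambda>x. vnorm (B *\<^sub>v x) / vnorm x) ` ?S)"
  proof (rule bdd_aboveI2)
    fix z assume z: "z \<in> ?S"
    then have "0 < vnorm z" using vnorm_pos_iff by blast
    then show "vnorm (B *\<^sub>v z) / vnorm z \<le> L2_set (\<lambda>i. vnorm (row B i)) {0..<k}"
      using vnorm_mult_mat_vec_frobenius[OF B, of z] z B by (simp add: pos_divide_le_eq)
  qed
  then have "vnorm (B *\<^sub>v x) / vnorm x \<le> mat_norm B"
    unfolding mat_norm_def using x False B by (intro cSUP_upper) auto
  then show ?thesis using pos by (simp add: pos_divide_le_eq)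
qed

text \<open>Needs one nonzero test vector, hence at least one column; over the empty set the sign of
  the \<open>SUP\<close> is unknown.\<close>

lemma mat_norm_nonneg:
  assumes B: "B \<in> carrier_mat k n" and "0 < n"
  shows "0 \<le> mat_norm B"
proof -
  have "0 < vnorm (unit_vec n 0 :: real vec)"
    using assms by (subst vnorm_pos_iff[of _ n]) (auto simp: unit_vec_def vec_eq_iff)
  moreover have "0 \<le> mat_norm B * vnorm (unit_vec n 0 :: real vec)"
    by (rule order_trans[OF vnorm_nonneg vnorm_mult_mat_vec_le[OF B]]) simp
  ultimately show ?thesis by (simp add: zero_le_mult_iff)
qed

lemma scalar_prod_mult_mat_vec_transpose:
  fixes B :: "'a :: comm_semiring_0 mat"
  assumes B: "B \<in> carrier_mat k n" and x: "x \<in> carrier_vec n" and y: "y \<in> carrier_vec k"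
  shows "(B *\<^sub>v x) \<bullet> y = x \<bullet> (transpose_mat B *\<^sub>v y)"
proof -
  have Bx: "B *\<^sub>v x \<in> carrier_vec k" using B x by simp
  have By: "transpose_mat B *\<^sub>v y \<in> carrier_vec n" using B y by simp
  show ?thesis
    unfolding comm_scalar_prod[OF Bx y] comm_scalar_prod[OF x By]
    by (rule transpose_vec_mult_scalar[OF B x y, symmetric])
qed

lemma scalar_prod_mult_mat_vec_sym:
  fixes S :: "'a :: comm_semiring_0 mat"
  assumes "S \<in> carrier_mat n n" "transpose_mat S = S" "x \<in> carrier_vec n" "y \<in> carrier_vec n"
  shows "(S *\<^sub>v x) \<bullet> y = x \<bullet> (S *\<^sub>v y)"
  using scalar_prod_mult_mat_vec_transpose[of S n n x y] assms by simp

section \<open>SPD matrices and their inverses\<close>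

lemma spd_matD:
  assumes "spd_mat S" "S \<in> carrier_mat n n"
  shows "transpose_mat S = S"
    and "\<And>x. x \<in> carrier_vec n \<Longrightarrow> x \<noteq> 0\<^sub>v n \<Longrightarrow> 0 < x \<bullet> (S *\<^sub>v x)"
  using assms by (auto simp: spd_mat_def)

lemma spd_matI:
  assumes "S \<in> carrier_mat n n" "transpose_mat S = S"
    and "\<And>x. x \<in> carrier_vec n \<Longrightarrow> x \<noteq> 0\<^sub>v n \<Longrightarrow> 0 < x \<bullet> (S *\<^sub>v x)"
  shows "spd_mat S"
  using assms by (auto simp: spd_mat_def square_mat.simps)

text \<open>A trivial kernel makes the determinant nonzero and so excludes the result
  \<open>None\<close> of \<open>mat_inverse\<close>, at which \<open>the\<close> is
  unspecified.\<close>

lemma inv_mat_props: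
  assumes S: "S \<in> carrier_mat n n"
    and ker: "\<And>x. x \<in> carrier_vec n \<Longrightarrow> S *\<^sub>v x = 0\<^sub>v n \<Longrightarrow> x = 0\<^sub>v n"
  shows "inv_mat S \<in> carrier_mat n n" "S * inv_mat S = 1\<^sub>m n" "inv_mat S * S = 1\<^sub>m n"
proof -
  have "det S \<noteq> 0" using det_0_iff_vec_prod_zero_field[OF S] ker by blast
  then have "S \<in> Units (ring_mat TYPE(real) n ())" by (rule det_non_zero_imp_unit[OF S])
  then obtain B where B: "mat_inverse S = Some B"
    using mat_inverse(1)[OF S, where b="()"] by (cases "mat_inverse S") auto
  show "inv_mat S \<in> carrier_mat n n" "S * inv_mat S = 1\<^sub>m n" "inv_mat S * S = 1\<^sub>m n"
    using mat_inverse(2)[OF S B] B by (auto simp: inv_mat_def)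
qed

lemma spd_mat_ker:
  assumes "spd_mat S" "S \<in> carrier_mat n n" "x \<in> carrier_vec n" "S *\<^sub>v x = 0\<^sub>v n"
  shows "x = 0\<^sub>v n"
  using spd_matD(2)[OF assms(1,2,3)] assms by fastforce

lemmas spd_inv_mat = inv_mat_props[OF _ spd_mat_ker]

lemma spd_inv_mat_mult_vec:
  assumes S: "spd_mat S" "S \<in> carrier_mat n n" and x: "x \<in> carrier_vec n"
  shows "S *\<^sub>v (inv_mat S *\<^sub>v x) = x" "inv_mat S *\<^sub>v (S *\<^sub>v x) = x"
    "inv_mat S *\<^sub>v x \<in> carrier_vec n"
proof -
  note I = spd_inv_mat[OF S(2) S]
  show "S *\<^sub>v (inv_mat S *\<^sub>v x) = x"
    using assoc_mult_mat_vec[OF S(2) I(1) x] I(2) x by simp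
  show "inv_mat S *\<^sub>v (S *\<^sub>v x) = x"
    using assoc_mult_mat_vec[OF I(1) S(2) x] I(3) x by simp
  show "inv_mat S *\<^sub>v x \<in> carrier_vec n" using I(1) x by simp
qed

section \<open>Square roots of SPD matrices\<close>

lemma mat_eqI_mult_vec:
  fixes B :: "'a :: semiring_1 mat"
  assumes B: "B \<in> carrier_mat k n" and C: "C \<in> carrier_mat k n"
    and eq: "\<And>x. x \<in> carrier_vec n \<Longrightarrow> B *\<^sub>v x = C *\<^sub>v x"
  shows "B = C"
proof (rule eq_matI)
  fix i j assume ij: "i < dim_row C" "j < dim_col C"
  have "(B *\<^sub>v unit_vec n j) $ i = (C *\<^sub>v unit_vec n j) $ i" by (simp add: eq)
  then show "B $$ (i, j) = C $$ (i, j)" using ij B C by (simp add: scalar_prod_right_unit)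
qed (use B C in auto)

text \<open>The complexified matrix has an eigenvector z with real part x and imaginary part y.
  Testing symmetry on the pair x, y cancels the \<open>Re c\<close> terms and leaves
  \<open>Im c\<close> times the sum of the squared norms equal to zero. So the eigenvalue is real,
  and whichever of x, y is nonzero is a real eigenvector.\<close>

lemma symmetric_mat_real_eigenvector:
  fixes A :: "real mat"
  assumes A: "A \<in> carrier_mat n n" and sym: "transpose_mat A = A" and "0 < n"
  obtains k v where "v \<in> carrier_vec n" "v \<noteq> 0\<^sub>v n" "A *\<^sub>v v = k \<cdot>\<^sub>v v"
proof -
  let ?C = "map_mat complex_of_real A"
  have C: "?C \<in> carrier_mat n n" using A by simp
  obtain c where "eigenvalue ?C c" using spectrum_non_empty[OF C \<open>0 < n\<close>] by (auto simp: spectrum_def)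
  then obtain z where z: "z \<in> carrier_vec n" "z \<noteq> 0\<^sub>v n" "?C *\<^sub>v z = c \<cdot>\<^sub>v z"
    using C by (auto simp: eigenvalue_def eigenvector_def)
  define x y where "x = map_vec Re z" and "y = map_vec Im z"
  have xy: "x \<in> carrier_vec n" "y \<in> carrier_vec n" using z(1) by (auto simp: x_def y_def)
  have idx: "(\<Sum>j<n. complex_of_real (A $$ (i, j)) * z $ j) = c * z $ i" if "i < n" for i
  proof -
    have "(?C *\<^sub>v z) $ i = c * z $ i" using z that by simp
    then show ?thesis using that A z(1)
      by (simp add: scalar_prod_def atLeast0LessThan)
  qed
  have Ax: "A *\<^sub>v x = Re c \<cdot>\<^sub>v x + (- Im c) \<cdot>\<^sub>v y"
  proof (rule eq_vecI)
    fix i assume "i < dim_vec (Re c \<cdot>\<^sub>v x + (- Im c) \<cdot>\<^sub>v y)"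
    then have i: "i < n" using xy by simp
    show "(A *\<^sub>v x) $ i = (Re c \<cdot>\<^sub>v x + (- Im c) \<cdot>\<^sub>v y) $ i"
      using arg_cong[OF idx[OF i], of Re] i A z(1)
      by (simp add: scalar_prod_def atLeast0LessThan x_def y_def)
  qed (use A xy in auto)
  have Ay: "A *\<^sub>v y = Im c \<cdot>\<^sub>v x + Re c \<cdot>\<^sub>v y"
  proof (rule eq_vecI)
    fix i assume "i < dim_vec (Im c \<cdot>\<^sub>v x + Re c \<cdot>\<^sub>v y)"
    then have i: "i < n" using xy by simp
    show "(A *\<^sub>v y) $ i = (Im c \<cdot>\<^sub>v x + Re c \<cdot>\<^sub>v y) $ i"
      using arg_cong[OF idx[OF i], of Im] i A z(1)
      by (simp add: scalar_prod_def atLeast0LessThan x_def y_def algebra_simps)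
  qed (use A xy in auto)
  have nz: "x \<noteq> 0\<^sub>v n \<or> y \<noteq> 0\<^sub>v n"
  proof (rule ccontr)
    assume "\<not> ?thesis"
    then have "\<And>i. i < n \<Longrightarrow> x $ i = 0 \<and> y $ i = 0" by simp
    then have "\<And>i. i < n \<Longrightarrow> z $ i = 0" using z(1) by (auto simp: x_def y_def complex_eq_iff)
    then have "z = 0\<^sub>v n" using z(1) by (intro eq_vecI) auto
    then show False using z(2) by simp
  qed
  have "(A *\<^sub>v x) \<bullet> y = x \<bullet> (A *\<^sub>v y)" by (rule scalar_prod_mult_mat_vec_sym[OF A sym xy])
  then have "Re c * (x \<bullet> y) - Im c * (y \<bullet> y) = Im c * (x \<bullet> x) + Re c * (x \<bullet> y)"
    unfolding Ax Ay using xy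
    by (simp add: add_scalar_prod_distrib[where n=n] scalar_prod_add_distrib[where n=n])
  then have "Im c * ((vnorm x)\<^sup>2 + (vnorm y)\<^sup>2) = 0"
    by (simp add: scalar_prod_self_eq_vnorm algebra_simps)
  moreover have "(vnorm x)\<^sup>2 + (vnorm y)\<^sup>2 \<noteq> 0"
    using nz vnorm_eq_0_iff[OF xy(1)] vnorm_eq_0_iff[OF xy(2)]
    by (simp add: sum_power2_eq_zero_iff)
  ultimately have "Im c = 0" by (simp only: mult_eq_0_iff) simp
  then have "A *\<^sub>v x = Re c \<cdot>\<^sub>v x" "A *\<^sub>v y = Re c \<cdot>\<^sub>v y"
    unfolding Ax Ay using xy by (auto intro!: eq_vecI)
  then show ?thesis using nz xy that by blast
qed

text \<open>The Householder reflection in the hyperplane orthogonal to \<open>w = v - e\<close>. It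
  will move a unit eigenvector onto the first coordinate axis; being symmetric and its own inverse,
  it turns the similarity into a congruence.\<close>

lemma householder_reflection:
  fixes v :: "real vec"
  assumes v: "v \<in> carrier_vec n" and e: "e \<in> carrier_vec n" and vv: "v \<bullet> v = 1" and ee: "e \<bullet> e = 1"
  obtains U where "U \<in> carrier_mat n n" "transpose_mat U = U" "U * U = 1\<^sub>m n" "U *\<^sub>v e = v"
proof (cases "v = e")
  case True
  then show ?thesis using that[of "1\<^sub>m n"] v by simp
next
  case False
  define w where "w = v - e"
  have w: "w \<in> carrier_vec n" using v e by (simp add: w_def)
  define c where "c = 2 / (w \<bullet> w)"
  have "w \<noteq> 0\<^sub>v n"
  proof
    assume "w = 0\<^sub>v n"
    then have "\<And>i. i < n \<Longrightarrow> (v - e) $ i = 0" by (simp add: w_def)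
    then have "\<And>i. i < n \<Longrightarrow> v $ i = e $ i" using v e by simp
    then have "v = e" using v e by (intro eq_vecI) auto
    then show False using False by simp
  qed
  then have ww: "w \<bullet> w \<noteq> 0" using vnorm_eq_0_iff[OF w] by (simp add: scalar_prod_self_eq_vnorm)
  define U where "U = mat n n (\<lambda>(i, j). (if i = j then 1 else 0) - c * w $ i * w $ j)"
  have U: "U \<in> carrier_mat n n" by (simp add: U_def)
  have sym: "transpose_mat U = U" by (rule eq_matI) (auto simp: U_def)
  have act: "U *\<^sub>v x = x - (c * (w \<bullet> x)) \<cdot>\<^sub>v w" if x: "x \<in> carrier_vec n" for x
  proof (rule eq_vecI)
    fix i assume "i < dim_vec (x - (c * (w \<bullet> x)) \<cdot>\<^sub>v w)"
    then have i: "i < n" using w by simp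
    have "(U *\<^sub>v x) $ i = (\<Sum>j\<in>{0..<n}. ((if i = j then 1 else 0) - c * w $ i * w $ j) * x $ j)"
      using i x by (simp add: U_def scalar_prod_def)
    also have "\<dots> = (\<Sum>j\<in>{0..<n}. if i = j then x $ j else 0) - (\<Sum>j\<in>{0..<n}. c * w $ i * w $ j * x $ j)"
      unfolding sum_subtractf[symmetric] by (intro sum.cong) (auto simp: algebra_simps)
    also have "\<dots> = x $ i - c * (w \<bullet> x) * w $ i"
      using i x by (simp add: scalar_prod_def sum_distrib_left sum_distrib_right algebra_simps)
    finally show "(U *\<^sub>v x) $ i = (x - (c * (w \<bullet> x)) \<cdot>\<^sub>v w) $ i" using i x w by simp
  qed (use U w that in auto)
  have cww: "c * (w \<bullet> w) = 2" using ww by (simp add: c_def)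
  have UU: "U *\<^sub>v (U *\<^sub>v x) = x" if x: "x \<in> carrier_vec n" for x
  proof -
    have "w \<bullet> (U *\<^sub>v x) = w \<bullet> x - (c * (w \<bullet> w)) * (w \<bullet> x)"
      using x w by (simp add: act scalar_prod_minus_distrib[where n=n])
    then have "w \<bullet> (U *\<^sub>v x) = - (w \<bullet> x)" using cww by simp
    moreover have "U *\<^sub>v (U *\<^sub>v x) = U *\<^sub>v x - (c * (w \<bullet> (U *\<^sub>v x))) \<cdot>\<^sub>v w"
      using U x by (intro act) simp
    ultimately show ?thesis using x w by (intro eq_vecI) (auto simp: act)
  qed
  have sq: "U * U = 1\<^sub>m n"
  proof (rule mat_eqI_mult_vec)
    fix x :: "real vec" assume x: "x \<in> carrier_vec n"
    then show "U * U *\<^sub>v x = 1\<^sub>m n *\<^sub>v x" using UU[OF x] assoc_mult_mat_vec[OF U U x] by simp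
  qed (use U in auto)
  \<comment> \<open>Because both vectors have unit length, \<open>w \<bullet> w\<close> is -2 times
    \<open>w \<bullet> e\<close>; hence the reflection adds exactly \<open>w\<close> to
    \<open>e\<close>.\<close>
  have "w \<bullet> w = 2 - 2 * (v \<bullet> e)" "w \<bullet> e = v \<bullet> e - 1"
    using v e vv ee comm_scalar_prod[OF v e]
    by (simp_all add: w_def scalar_prod_minus_distrib[where n=n] minus_scalar_prod_distrib[where n=n])
  then have "c * (w \<bullet> e) = - 1" using ww by (simp add: c_def field_simps)
  then have "U *\<^sub>v e = v" unfolding act[OF e] using v e by (auto simp: w_def)
  then show ?thesis using that U sym sq by blast
qed

text \<open>The quadratic form of the new matrix at x is that of \<open>S\<close> at
  \<open>Q\<close> x. It serves both for the reflections below and, with \<open>S\<close> the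
  identity, for the Gram matrix of an interpolation.\<close>

lemma spd_mat_congruence:
  assumes S: "spd_mat S" "S \<in> carrier_mat n n" and Q: "Q \<in> carrier_mat n k"
    and inj: "\<And>x. x \<in> carrier_vec k \<Longrightarrow> Q *\<^sub>v x = 0\<^sub>v n \<Longrightarrow> x = 0\<^sub>v k"
  shows "spd_mat (transpose_mat Q * S * Q)"
proof (rule spd_matI)
  show "transpose_mat Q * S * Q \<in> carrier_mat k k" using S Q by simp
  show "transpose_mat (transpose_mat Q * S * Q) = transpose_mat Q * S * Q"
    using S Q spd_matD(1)[OF S] assoc_mult_mat[of "transpose_mat Q" k n S n Q k]
      transpose_mult[of "transpose_mat Q * S" k n Q k] transpose_mult[of "transpose_mat Q" k n S n]
    by simp
  fix x :: "real vec" assume x: "x \<in> carrier_vec k" "x \<noteq> 0\<^sub>v k"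
  have Qx: "Q *\<^sub>v x \<in> carrier_vec n" "Q *\<^sub>v x \<noteq> 0\<^sub>v n" using x Q inj by auto
  have "(transpose_mat Q * S * Q) *\<^sub>v x = transpose_mat Q *\<^sub>v (S *\<^sub>v (Q *\<^sub>v x))"
    using S Q x(1) by (simp add: assoc_mult_mat_vec[where ?n\<^sub>1=k and ?n\<^sub>2=n and ?n\<^sub>3=k]
        assoc_mult_mat_vec[where ?n\<^sub>1=k and ?n\<^sub>2=n and ?n\<^sub>3=n])
  then have "x \<bullet> ((transpose_mat Q * S * Q) *\<^sub>v x) = (Q *\<^sub>v x) \<bullet> (S *\<^sub>v (Q *\<^sub>v x))"
    using scalar_prod_mult_mat_vec_transpose[OF Q x(1), of "S *\<^sub>v (Q *\<^sub>v x)"] S Q x by simp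
  then show "0 < x \<bullet> ((transpose_mat Q * S * Q) *\<^sub>v x)" using spd_matD(2)[OF S Qx] by simp
qed

abbreviation diag_block :: "nat \<Rightarrow> real \<Rightarrow> real mat \<Rightarrow> real mat" where
  "diag_block n k S \<equiv> four_block_mat (mat 1 1 (\<lambda>_. k)) (0\<^sub>m 1 n) (0\<^sub>m n 1) S"

lemma diag_block_quadratic_form:
  assumes S: "S \<in> carrier_mat n n" and a: "a \<in> carrier_vec 1" and x: "x \<in> carrier_vec n"
  shows "(a @\<^sub>v x) \<bullet> (diag_block n k S *\<^sub>v (a @\<^sub>v x)) = k * (a $ 0)\<^sup>2 + x \<bullet> (S *\<^sub>v x)"
proof -
  let ?K = "mat 1 1 (\<lambda>_. k)"
  have K: "?K \<in> carrier_mat 1 1" by simp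
  have "(a @\<^sub>v x) \<bullet> (diag_block n k S *\<^sub>v (a @\<^sub>v x)) = a \<bullet> (?K *\<^sub>v a) + x \<bullet> (S *\<^sub>v x)"
    unfolding mult_mat_vec_split[OF K S a x]
    using S x by (intro scalar_prod_append[OF a x mult_mat_vec_carrier[OF K a]]) simp
  also have "a \<bullet> (?K *\<^sub>v a) = k * (a $ 0)\<^sup>2"
    using a by (simp add: scalar_prod_def power2_eq_square)
  finally show ?thesis .
qed

text \<open>One direction passes definiteness to the deflated block so that the induction can
  continue; the other gives it back to the square root assembled from the blocks.\<close>

lemma spd_mat_diag_block_iff:
  assumes S: "S \<in> carrier_mat n n"
  shows "spd_mat (diag_block n k S) \<longleftrightarrow> 0 < k \<and> spd_mat S"
proof
  let ?D = "diag_block n k S"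
  have D: "?D \<in> carrier_mat (1 + n) (1 + n)" using S by auto
  have tr: "transpose_mat ?D = diag_block n k (transpose_mat S)"
    using S by (subst transpose_four_block_mat[where ?nr1.0=1 and ?nc1.0=1 and ?nr2.0=n and ?nc2.0=n]) (auto intro!: eq_matI)
  {
    assume *: "spd_mat ?D"
    have "S $$ (i, j) = S $$ (j, i)" if "i < n" "j < n" for i j
    proof -
      have "transpose_mat ?D $$ (Suc i, Suc j) = ?D $$ (Suc i, Suc j)"
        using spd_matD(1)[OF * D] by simp
      then show ?thesis using that S by simp
    qed
    then have "transpose_mat S = S" using S by (intro eq_matI) auto
    moreover have "0 < x \<bullet> (S *\<^sub>v x)" if x: "x \<in> carrier_vec n" "x \<noteq> 0\<^sub>v n" for x
    proof -
      have "0\<^sub>v 1 @\<^sub>v x \<noteq> 0\<^sub>v (1 + n)"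
      proof
        assume "0\<^sub>v 1 @\<^sub>v x = 0\<^sub>v (1 + n)"
        then have "\<And>i. i < n \<Longrightarrow> (0\<^sub>v 1 @\<^sub>v x) $ (Suc i) = 0" by simp
        then have "x = 0\<^sub>v n" using x(1) by (intro eq_vecI) auto
        then show False using x by simp
      qed
      then show ?thesis
        using spd_matD(2)[OF * D append_carrier_vec[OF zero_carrier_vec x(1)]] diag_block_quadratic_form[OF S, of "0\<^sub>v 1" x k] x
        by (simp del: One_nat_def)
    qed
    ultimately have "spd_mat S" using S by (intro spd_matI) auto
    moreover have "0 < k"
    proof -
      let ?a = "vec 1 (\<lambda>_. 1) :: real vec"
      have "?a @\<^sub>v 0\<^sub>v n \<noteq> 0\<^sub>v (1 + n)"
      proof
        assume "?a @\<^sub>v 0\<^sub>v n = 0\<^sub>v (1 + n)"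
        then have "(?a @\<^sub>v 0\<^sub>v n) $ 0 = 0" by simp
        then show False by simp
      qed
      then show ?thesis
        using spd_matD(2)[OF * D append_carrier_vec[OF vec_carrier zero_carrier_vec], of "\<lambda>_. 1"] diag_block_quadratic_form[OF S, of ?a "0\<^sub>v n" k] S
        by (simp del: One_nat_def)
    qed
    ultimately show "0 < k \<and> spd_mat S" by simp
  next
    assume *: "0 < k \<and> spd_mat S"
    show "spd_mat ?D"
    proof (rule spd_matI[OF D])
      show "transpose_mat ?D = ?D" using tr spd_matD(1)[OF conjunct2[OF *] S] by simp
      fix x :: "real vec" assume x: "x \<in> carrier_vec (1 + n)" "x \<noteq> 0\<^sub>v (1 + n)"
      define a y where "a = vec_first x 1" and "y = vec_last x n"
      have a: "a \<in> carrier_vec 1" and y: "y \<in> carrier_vec n" and xay: "x = a @\<^sub>v y"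
        using x by (auto simp: a_def y_def)
      have y0: "0 \<le> y \<bullet> (S *\<^sub>v y)"
        using spd_matD(2)[OF conjunct2[OF *] S y] S by (cases "y = 0\<^sub>v n") auto
      have "0 < k * (a $ 0)\<^sup>2 + y \<bullet> (S *\<^sub>v y)"
      proof (cases "y = 0\<^sub>v n")
        case True
        have "a $ 0 \<noteq> 0"
        proof
          assume "a $ 0 = 0"
          then have "x = 0\<^sub>v (1 + n)" using a True xay by (intro eq_vecI) auto
          then show False using x by simp
        qed
        then show ?thesis using * y0 by (simp add: add_pos_nonneg)
      next
        case False
        then show ?thesis using spd_matD(2)[OF conjunct2[OF *] S y] * by (simp add: add_nonneg_pos)
      qed
      then show "0 < x \<bullet> (?D *\<^sub>v x)" unfolding xay diag_block_quadratic_form[OF S a y] .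
    qed
  }
qed

text \<open>Existence is what unlocks the \<open>SOME\<close> in \<open>sqrt_mat\<close>. Induction
  on the dimension by deflation: after reflecting an eigenvector onto the first axis, the first
  column is diagonal by the eigenvalue equation and the first row by symmetry. The remaining block
  has a root by induction, and reflecting back gives a root of \<open>A\<close>.\<close>

lemma spd_sqrt_exists:
  assumes "A \<in> carrier_mat n n" "spd_mat A"
  shows "\<exists>R \<in> carrier_mat n n. spd_mat R \<and> R * R = A"
  using assms
proof (induction n arbitrary: A)
  case 0
  then have "A * A = A" by (intro eq_matI) auto
  then show ?case using 0 by blast
next
  case (Suc n)
  note A = Suc.prems(1) and spd = Suc.prems(2)
  obtain k v where v: "v \<in> carrier_vec (Suc n)" "v \<noteq> 0\<^sub>v (Suc n)" "A *\<^sub>v v = k \<cdot>\<^sub>v v"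
    using symmetric_mat_real_eigenvector[OF A spd_matD(1)[OF spd A]] by blast
  have nv: "0 < vnorm v" using v vnorm_pos_iff by blast
  define q where "q = (1 / vnorm v) \<cdot>\<^sub>v v"
  have q: "q \<in> carrier_vec (Suc n)" using v by (simp add: q_def)
  have "vnorm q = 1" using nv by (simp add: q_def vnorm_smult)
  then have qq: "q \<bullet> q = 1" by (simp add: scalar_prod_self_eq_vnorm)
  have Aq: "A *\<^sub>v q = k \<cdot>\<^sub>v q"
    unfolding q_def using v A by (simp add: mult_mat_vec[OF A] smult_smult_assoc mult.commute)
  let ?e = "unit_vec (Suc n) 0 :: real vec"
  obtain U where U: "U \<in> carrier_mat (Suc n) (Suc n)" "transpose_mat U = U" "U * U = 1\<^sub>m (Suc n)" "U *\<^sub>v ?e = q"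
    using householder_reflection[OF q _ qq, of ?e] by auto
  have inj: "x = 0\<^sub>v (Suc n)" if "x \<in> carrier_vec (Suc n)" "U *\<^sub>v x = 0\<^sub>v (Suc n)" for x
  proof -
    have "U *\<^sub>v (U *\<^sub>v x) = x" using assoc_mult_mat_vec[OF U(1,1) that(1)] U(3) that by simp
    then show ?thesis using that U(1) by auto
  qed
  define B where "B = U * A * U"
  have B: "B \<in> carrier_mat (Suc n) (Suc n)" using U A by (simp add: B_def)
  have spdB: "spd_mat B" using spd_mat_congruence[OF spd A U(1) inj] U(2) by (simp add: B_def)
  have Be: "B *\<^sub>v ?e = k \<cdot>\<^sub>v ?e"
  proof -
    have Uq: "U *\<^sub>v q = ?e"
      using assoc_mult_mat_vec[OF U(1,1), of ?e] U(3,4) by simp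
    have "B *\<^sub>v ?e = U *\<^sub>v (A *\<^sub>v (U *\<^sub>v ?e))"
      unfolding B_def using U(1) A
      by (simp add: assoc_mult_mat_vec[where ?n\<^sub>1="Suc n" and ?n\<^sub>2="Suc n" and ?n\<^sub>3="Suc n"])
    then show ?thesis using Aq Uq U q by (simp add: mult_mat_vec[OF U(1)])
  qed
  have B0: "B $$ (i, 0) = (if i = 0 then k else 0)" if "i < Suc n" for i
  proof -
    have "(B *\<^sub>v ?e) $ i = B $$ (i, 0)" using B that by (simp add: scalar_prod_right_unit)
    then show ?thesis unfolding Be using that by (cases "i = 0") auto
  qed
  have B0': "B $$ (0, i) = (if i = 0 then k else 0)" if "i < Suc n" for i
  proof -
    have "B $$ (0, i) = transpose_mat B $$ (i, 0)" using B that by simp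
    then show ?thesis using spd_matD(1)[OF spdB B] B0[OF that] by simp
  qed
  define S where "S = mat n n (\<lambda>(i, j). B $$ (Suc i, Suc j))"
  have S: "S \<in> carrier_mat n n" by (simp add: S_def)
  have BS: "B = diag_block n k S"
  proof (rule eq_matI)
    fix i j assume "i < dim_row (diag_block n k S)" "j < dim_col (diag_block n k S)"
    then have "i < Suc n" "j < Suc n" using S by auto
    then show "B $$ (i, j) = diag_block n k S $$ (i, j)"
      using S B0[of i] B0'[of j] by (cases i; cases j) (auto simp: S_def)
  qed (use B S in auto)
  then have k: "0 < k" and spdS: "spd_mat S" using spdB spd_mat_diag_block_iff[OF S] by auto
  obtain T where T: "T \<in> carrier_mat n n" "spd_mat T" "T * T = S" using Suc.IH[OF S spdS] by blast
  define R where "R = diag_block n (sqrt k) T"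
  have R: "R \<in> carrier_mat (Suc n) (Suc n)" using T by (auto simp: R_def)
  have spdR: "spd_mat R" using spd_mat_diag_block_iff[OF T(1)] k T by (simp add: R_def)
  have RR: "R * R = B"
    unfolding R_def BS
    by (subst mult_four_block_mat[where ?nr1.0=1 and ?n1.0=1 and ?n2.0=n and ?nr2.0=n and ?nc1.0=1 and ?nc2.0=n])
      (use T k in \<open>auto intro!: eq_matI cong_four_block_mat simp: scalar_prod_def\<close>)
  have "(U * R * U) * (U * R * U) = U * R * (U * U) * R * U"
    using U(1) R by (simp add: assoc_mult_mat[where ?n\<^sub>1="Suc n" and ?n\<^sub>2="Suc n" and ?n\<^sub>3="Suc n" and ?n\<^sub>4="Suc n"])
  also have "\<dots> = U * (R * R) * U"
    using U R by (simp add: assoc_mult_mat[where ?n\<^sub>1="Suc n" and ?n\<^sub>2="Suc n" and ?n\<^sub>3="Suc n" and ?n\<^sub>4="Suc n"])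
  also have "\<dots> = (U * U) * A * (U * U)"
    unfolding RR B_def using U(1) A
    by (simp add: assoc_mult_mat[where ?n\<^sub>1="Suc n" and ?n\<^sub>2="Suc n" and ?n\<^sub>3="Suc n" and ?n\<^sub>4="Suc n"])
  also have "\<dots> = A" using U A by simp
  finally have "(U * R * U) * (U * R * U) = A" .
  moreover have "spd_mat (U * R * U)" using spd_mat_congruence[OF spdR R U(1) inj] U(2) by simp
  ultimately show ?case using U R by (intro bexI[of _ "U * R * U"]) auto
qed

lemma sqrt_mat_props:
  assumes A: "A \<in> carrier_mat n n" "spd_mat A"
  shows "sqrt_mat A \<in> carrier_mat n n" "spd_mat (sqrt_mat A)" "sqrt_mat A * sqrt_mat A = A"
proof -
  have "\<exists>R. spd_mat R \<and> R * R = A" using spd_sqrt_exists[OF A] by blast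
  then have *: "spd_mat (sqrt_mat A) \<and> sqrt_mat A * sqrt_mat A = A"
    unfolding sqrt_mat_def by (rule someI_ex)
  then show "spd_mat (sqrt_mat A)" "sqrt_mat A * sqrt_mat A = A" by auto
  have "dim_row (sqrt_mat A) = n" using * A(1) by (metis carrier_matD(1) index_mult_mat(2))
  then show "sqrt_mat A \<in> carrier_mat n n" using * by (auto simp: spd_mat_def square_mat.simps)
qed

section \<open>Energy norms and Galerkin coarsening\<close>

lemma energy_norm_nonneg [simp]: "0 \<le> energy_norm S x"
  by (simp add: energy_norm_def)

section \<open>Conversions between Euclidean and energy norms\<close>

context
  fixes A :: "real mat" and n :: nat
  assumes A: "A \<in> carrier_mat n n" and spd: "spd_mat A"
begin

lemma scalar_prod_spd_eq:
  assumes "x \<in> carrier_vec n" "y \<in> carrier_vec n"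
  shows "x \<bullet> (A *\<^sub>v y) = (sqrt_mat A *\<^sub>v x) \<bullet> (sqrt_mat A *\<^sub>v y)"
proof -
  note R = sqrt_mat_props[OF A spd]
  have "A *\<^sub>v y = sqrt_mat A *\<^sub>v (sqrt_mat A *\<^sub>v y)"
    using assoc_mult_mat_vec[OF R(1,1) assms(2)] R(3) by simp
  then show ?thesis
    using scalar_prod_mult_mat_vec_sym[OF R(1) spd_matD(1)[OF R(2,1)] assms(1)] assms R(1) by simp
qed

text \<open>Replaces the square root of the matrix by its quadratic form, on which the Galerkin
  relation can act.\<close>

lemma energy_norm_power2: "x \<in> carrier_vec n \<Longrightarrow> (energy_norm A x)\<^sup>2 = x \<bullet> (A *\<^sub>v x)"
  by (simp add: energy_norm_def scalar_prod_spd_eq scalar_prod_self_eq_vnorm)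

lemma energy_norm_eq_sqrt: "x \<in> carrier_vec n \<Longrightarrow> energy_norm A x = sqrt (x \<bullet> (A *\<^sub>v x))"
  by (metis energy_norm_power2 energy_norm_nonneg real_sqrt_unique)

lemma energy_norm_Cauchy_Schwarz:
  assumes "x \<in> carrier_vec n" "y \<in> carrier_vec n"
  shows "\<bar>x \<bullet> (A *\<^sub>v y)\<bar> \<le> energy_norm A x * energy_norm A y"
  unfolding scalar_prod_spd_eq[OF assms] energy_norm_def
  using sqrt_mat_props(1)[OF A spd] assms by (intro abs_scalar_prod_le[of _ n]) auto

lemma energy_norm_triangle:
  assumes "x \<in> carrier_vec n" "y \<in> carrier_vec n"
  shows "energy_norm A (x + y) \<le> energy_norm A x + energy_norm A y"
  unfolding energy_norm_def
  using sqrt_mat_props(1)[OF A spd] assms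
  by (subst mult_add_distrib_mat_vec[where nr=n and nc=n]) (auto intro!: vnorm_triangle[of _ n])

lemma energy_norm_triangle_minus:
  assumes "x \<in> carrier_vec n" "y \<in> carrier_vec n"
  shows "energy_norm A (x - y) \<le> energy_norm A x + energy_norm A y"
proof -
  have "x - y = x + (- 1) \<cdot>\<^sub>v y" using assms by (intro eq_vecI) auto
  moreover have "energy_norm A ((- 1) \<cdot>\<^sub>v y) = energy_norm A y"
    unfolding energy_norm_def using sqrt_mat_props(1)[OF A spd] assms
    by (subst mult_mat_vec[where nr=n and nc=n]) (auto simp: vnorm_smult)
  ultimately show ?thesis using energy_norm_triangle[OF assms(1), of "(- 1) \<cdot>\<^sub>v y"] assms by simp
qed

lemma energy_norm_zero [simp]: "energy_norm A (0\<^sub>v n) = 0"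
  using energy_norm_power2[of "0\<^sub>v n"] A by simp

lemma energy_norm_pos: "x \<in> carrier_vec n \<Longrightarrow> x \<noteq> 0\<^sub>v n \<Longrightarrow> 0 < energy_norm A x"
  using spd_matD(2)[OF spd A] by (simp add: energy_norm_eq_sqrt)

text \<open>First of four conversions. Each costs only the square root of the norm of
  \<open>A\<close> or of its inverse, since the quadratic form is the square of the energy norm; one
  conversion of each kind together cost \<open>sqrt (cond_num A)\<close>.\<close>

lemma energy_norm_le_vnorm:
  assumes x: "x \<in> carrier_vec n"
  shows "energy_norm A x \<le> sqrt (mat_norm A) * vnorm x"
proof -
  have "(energy_norm A x)\<^sup>2 \<le> vnorm x * vnorm (A *\<^sub>v x)"
    using abs_scalar_prod_le[OF x mult_mat_vec_carrier[OF A x]] x by (simp add: energy_norm_power2)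
  also have "\<dots> \<le> vnorm x * (mat_norm A * vnorm x)"
    by (intro mult_left_mono vnorm_mult_mat_vec_le[OF A x]) simp
  finally have "energy_norm A x \<le> sqrt (mat_norm A * (vnorm x)\<^sup>2)"
    by (intro real_le_rsqrt) (simp add: power2_eq_square mult_ac)
  then show ?thesis by (simp add: real_sqrt_mult)
qed

text \<open>Duality: the squared norm of \<open>A *\<^sub>v x\<close> is its energy inner product
  with x. After Cauchy-Schwarz and the previous conversion one common factor is cancelled.\<close>

lemma vnorm_mult_le_energy_norm:
  assumes x: "x \<in> carrier_vec n"
  shows "vnorm (A *\<^sub>v x) \<le> sqrt (mat_norm A) * energy_norm A x"
proof -
  have Ax: "A *\<^sub>v x \<in> carrier_vec n" using A x by simp
  have "vnorm (A *\<^sub>v x) * vnorm (A *\<^sub>v x) = (A *\<^sub>v x) \<bullet> (A *\<^sub>v x)"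
    by (simp add: scalar_prod_self_eq_vnorm power2_eq_square)
  also have "\<dots> \<le> energy_norm A (A *\<^sub>v x) * energy_norm A x"
    using energy_norm_Cauchy_Schwarz[OF Ax x] by simp
  also have "\<dots> \<le> (sqrt (mat_norm A) * vnorm (A *\<^sub>v x)) * energy_norm A x"
    by (intro mult_right_mono energy_norm_le_vnorm[OF Ax]) simp
  finally have "vnorm (A *\<^sub>v x) * vnorm (A *\<^sub>v x) \<le> vnorm (A *\<^sub>v x) * (sqrt (mat_norm A) * energy_norm A x)"
    by (simp add: mult_ac)
  then show ?thesis
  proof (cases "x = 0\<^sub>v n")
    case True
    then have "A *\<^sub>v x = 0\<^sub>v n" using A by auto
    then show ?thesis using True by simp
  next
    case False
    then have "A *\<^sub>v x \<noteq> 0\<^sub>v n" using spd_mat_ker[OF spd A x] by blast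
    then have "0 < vnorm (A *\<^sub>v x)" using vnorm_pos_iff[OF Ax] by simp
    then show ?thesis
      using \<open>vnorm (A *\<^sub>v x) * vnorm (A *\<^sub>v x) \<le> _\<close> by (rule mult_left_le_imp_le[rotated])
  qed
qed

lemma energy_norm_inv_le_vnorm:
  assumes x: "x \<in> carrier_vec n"
  shows "energy_norm A (inv_mat A *\<^sub>v x) \<le> sqrt (mat_norm (inv_mat A)) * vnorm x"
proof -
  note I = spd_inv_mat_mult_vec[OF spd A x]
  note Ic = spd_inv_mat(1)[OF A spd A]
  have "(energy_norm A (inv_mat A *\<^sub>v x))\<^sup>2 = (inv_mat A *\<^sub>v x) \<bullet> x"
    using energy_norm_power2[OF I(3)] I(1) by simp
  also have "\<dots> \<le> vnorm (inv_mat A *\<^sub>v x) * vnorm x"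
    using abs_scalar_prod_le[OF I(3) x] by simp
  also have "\<dots> \<le> (mat_norm (inv_mat A) * vnorm x) * vnorm x"
    by (intro mult_right_mono vnorm_mult_mat_vec_le[OF Ic x]) simp_all
  finally have "energy_norm A (inv_mat A *\<^sub>v x) \<le> sqrt (mat_norm (inv_mat A) * (vnorm x)\<^sup>2)"
    by (intro real_le_rsqrt) (simp add: power2_eq_square mult_ac)
  then show ?thesis by (simp add: real_sqrt_mult)
qed

lemma vnorm_le_energy_norm:
  assumes x: "x \<in> carrier_vec n"
  shows "vnorm x \<le> sqrt (mat_norm (inv_mat A)) * energy_norm A x"
proof (cases "x = 0\<^sub>v n")
  case False
  note I = spd_inv_mat_mult_vec[OF spd A x]
  have "vnorm x * vnorm x = x \<bullet> (A *\<^sub>v (inv_mat A *\<^sub>v x))"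
    by (simp add: I scalar_prod_self_eq_vnorm power2_eq_square)
  also have "\<dots> \<le> energy_norm A x * energy_norm A (inv_mat A *\<^sub>v x)"
    using energy_norm_Cauchy_Schwarz[OF x I(3)] by simp
  also have "\<dots> \<le> energy_norm A x * (sqrt (mat_norm (inv_mat A)) * vnorm x)"
    by (intro mult_left_mono energy_norm_inv_le_vnorm[OF x]) simp
  finally have "vnorm x * vnorm x \<le> vnorm x * (sqrt (mat_norm (inv_mat A)) * energy_norm A x)"
    by (simp add: mult_ac)
  moreover have "0 < vnorm x" using False vnorm_pos_iff[OF x] by simp
  ultimately show ?thesis by (rule mult_left_le_imp_le)
qed simp

text \<open>Lets a bare unit roundoff be absorbed into \<tau>.\<close>

lemma cond_num_spd_ge_1:
  assumes "0 < n"
  shows "1 \<le> cond_num A"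
proof -
  let ?e = "unit_vec n 0 :: real vec"
  have e: "?e \<in> carrier_vec n" by simp
  have pos: "0 < vnorm ?e"
    using assms by (subst vnorm_pos_iff[of _ n]) (auto simp: unit_vec_def vec_eq_iff)
  note Ic = spd_inv_mat(1)[OF A spd A]
  have "vnorm ?e = vnorm (inv_mat A *\<^sub>v (A *\<^sub>v ?e))"
    by (simp add: spd_inv_mat_mult_vec[OF spd A e])
  also have "\<dots> \<le> mat_norm (inv_mat A) * vnorm (A *\<^sub>v ?e)"
    by (rule vnorm_mult_mat_vec_le[OF Ic mult_mat_vec_carrier[OF A e]])
  also have "\<dots> \<le> mat_norm (inv_mat A) * (mat_norm A * vnorm ?e)"
    by (intro mult_left_mono vnorm_mult_mat_vec_le[OF A e] mat_norm_nonneg[OF Ic assms])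
  finally have "1 * vnorm ?e \<le> cond_num A * vnorm ?e" by (simp add: cond_num_def mult_ac)
  then show ?thesis using pos by (rule mult_right_le_imp_le)
qed

lemma energy_norm_mult_le_energy_mat_norm:
  assumes B: "B \<in> carrier_mat n n" and x: "x \<in> carrier_vec n"
  shows "energy_norm A (B *\<^sub>v x) \<le> energy_mat_norm A B * energy_norm A x"
proof (cases "x = 0\<^sub>v n")
  case True
  with B have "B *\<^sub>v x = 0\<^sub>v n" by auto
  then show ?thesis using True by simp
next
  case False
  have n0: "0 < n"
  proof (rule ccontr)
    assume "\<not> 0 < n"
    then have "x = 0\<^sub>v n" using x by (intro eq_vecI) auto
    then show False using False by simp
  qed
  let ?S = "carrier_vec (dim_col B) - {0\<^sub>v (dim_col B)} :: real vec set"
  \<comment> \<open>A crude bound by passing to the Euclidean norm and back; it serves only to show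
    that the quotients are bounded, so that their \<open>SUP\<close> is an upper bound.\<close>
  let ?c = "sqrt (mat_norm A) * (mat_norm B * sqrt (mat_norm (inv_mat A)))"
  have "bdd_above ((\<lambda>x. energy_norm A (B *\<^sub>v x) / energy_norm A x) ` ?S)"
  proof (rule bdd_aboveI2)
    fix z assume "z \<in> ?S"
    then have z: "z \<in> carrier_vec n" "z \<noteq> 0\<^sub>v n" using B by auto
    have "energy_norm A (B *\<^sub>v z) \<le> sqrt (mat_norm A) * vnorm (B *\<^sub>v z)"
      using B z by (intro energy_norm_le_vnorm) simp
    also have "\<dots> \<le> sqrt (mat_norm A) * (mat_norm B * vnorm z)"
      using mat_norm_nonneg[OF A n0] by (intro mult_left_mono vnorm_mult_mat_vec_le[OF B z(1)]) simp
    also have "\<dots> \<le> sqrt (mat_norm A) * (mat_norm B * (sqrt (mat_norm (inv_mat A)) * energy_norm A z))"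
      using mat_norm_nonneg[OF A n0] mat_norm_nonneg[OF B n0]
      by (intro mult_left_mono vnorm_le_energy_norm[OF z(1)]) simp_all
    finally show "energy_norm A (B *\<^sub>v z) / energy_norm A z \<le> ?c"
      using energy_norm_pos[OF z] by (simp add: pos_divide_le_eq mult_ac)
  qed
  then have "energy_norm A (B *\<^sub>v x) / energy_norm A x \<le> energy_mat_norm A B"
    unfolding energy_mat_norm_def using x False B by (intro cSUP_upper) auto
  then show ?thesis using energy_norm_pos[OF x False] by (simp add: pos_divide_le_eq)
qed

end

section \<open>Galerkin coarse matrix and interpolation\<close>

context
  fixes A P :: "real mat" and n k :: nat
  assumes A: "A \<in> carrier_mat n n" and spd: "spd_mat A"
    and P: "P \<in> carrier_mat n k" and n: "0 < n" and k: "0 < k" and spdC: "spd_mat (transpose_mat P * A * P)"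
begin

lemma galerkin_mult_vec:
  assumes x: "x \<in> carrier_vec k"
  shows "(transpose_mat P * A * P) *\<^sub>v x = transpose_mat P *\<^sub>v (A *\<^sub>v (P *\<^sub>v x))"
  using A P x by (simp add: assoc_mult_mat_vec[where ?n\<^sub>1=k and ?n\<^sub>2=n and ?n\<^sub>3=k]
      assoc_mult_mat_vec[where ?n\<^sub>1=k and ?n\<^sub>2=n and ?n\<^sub>3=n])

lemma galerkin_carrier: "transpose_mat P * A * P \<in> carrier_mat k k"
  using A P by simp

text \<open>A vector killed by \<open>P\<close> is killed by the coarse matrix, which is
  definite.\<close>

lemma interpolation_ker:
  assumes x: "x \<in> carrier_vec k" and Px: "P *\<^sub>v x = 0\<^sub>v n"
  shows "x = 0\<^sub>v k"
proof (rule spd_mat_ker[OF spdC galerkin_carrier x])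
  have "A *\<^sub>v 0\<^sub>v n = 0\<^sub>v n" "transpose_mat P *\<^sub>v 0\<^sub>v n = 0\<^sub>v k" using A P by auto
  then show "(transpose_mat P * A * P) *\<^sub>v x = 0\<^sub>v k" by (simp add: galerkin_mult_vec[OF x] Px)
qed

lemma gram_carrier: "transpose_mat P * P \<in> carrier_mat k k"
  using P by simp

lemma spd_gram: "spd_mat (transpose_mat P * P)"
proof -
  have "spd_mat (1\<^sub>m n :: real mat)"
    by (rule spd_matI[of _ n]) (auto simp: scalar_prod_self_eq_vnorm vnorm_eq_0_iff)
  then show ?thesis using spd_mat_congruence[of "1\<^sub>m n" n P k] P interpolation_ker by simp
qed

text \<open>Makes the four conversions available for the Gram matrix; this is how the condition
  number of the Gram matrix enters the analysis.\<close>

lemma energy_norm_gram: "x \<in> carrier_vec k \<Longrightarrow> energy_norm (transpose_mat P * P) x = vnorm (P *\<^sub>v x)"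
  using P scalar_prod_mult_mat_vec_transpose[OF P, of x "P *\<^sub>v x"]
  by (simp add: energy_norm_eq_sqrt[OF gram_carrier spd_gram] vnorm_def
      assoc_mult_mat_vec[where ?n\<^sub>1=k and ?n\<^sub>2=n and ?n\<^sub>3=k])

lemma vnorm_interpolation_le:
  "x \<in> carrier_vec k \<Longrightarrow> vnorm (P *\<^sub>v x) \<le> sqrt (mat_norm (transpose_mat P * P)) * vnorm x"
  using energy_norm_le_vnorm[OF gram_carrier spd_gram] by (simp add: energy_norm_gram)

lemma vnorm_le_interpolation:
  "x \<in> carrier_vec k \<Longrightarrow> vnorm x \<le> sqrt (mat_norm (inv_mat (transpose_mat P * P))) * vnorm (P *\<^sub>v x)"
  using vnorm_le_energy_norm[OF gram_carrier spd_gram] by (simp add: energy_norm_gram)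

text \<open>Duality: pair the restricted vector with itself, move \<open>P\<close> across the scalar
  product, and cancel one factor.\<close>

lemma vnorm_restriction_le:
  assumes z: "z \<in> carrier_vec n"
  shows "vnorm (transpose_mat P *\<^sub>v z) \<le> sqrt (mat_norm (transpose_mat P * P)) * vnorm z"
proof (cases "transpose_mat P *\<^sub>v z = 0\<^sub>v k")
  case True
  then show ?thesis using mat_norm_nonneg[OF gram_carrier k] by simp
next
  case False
  let ?y = "transpose_mat P *\<^sub>v z"
  have y: "?y \<in> carrier_vec k" using P z by simp
  have "vnorm ?y * vnorm ?y = (P *\<^sub>v ?y) \<bullet> z"
    using scalar_prod_mult_mat_vec_transpose[OF P y z] by (simp add: scalar_prod_self_eq_vnorm power2_eq_square)
  also have "\<dots> \<le> vnorm (P *\<^sub>v ?y) * vnorm z"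
    using abs_scalar_prod_le[OF mult_mat_vec_carrier[OF P y] z] by simp
  also have "\<dots> \<le> (sqrt (mat_norm (transpose_mat P * P)) * vnorm ?y) * vnorm z"
    by (intro mult_right_mono vnorm_interpolation_le[OF y]) simp
  finally have "vnorm ?y * vnorm ?y \<le> vnorm ?y * (sqrt (mat_norm (transpose_mat P * P)) * vnorm z)"
    by (simp add: mult_ac)
  moreover have "0 < vnorm ?y" using False vnorm_pos_iff[OF y] by simp
  ultimately show ?thesis by (rule mult_left_le_imp_le)
qed

text \<open>The reason why an error of the coarse cycle enters the finer level with factor
  one.\<close>

lemma energy_norm_galerkin:
  assumes x: "x \<in> carrier_vec k"
  shows "energy_norm (transpose_mat P * A * P) x = energy_norm A (P *\<^sub>v x)"
proof -
  have Px: "P *\<^sub>v x \<in> carrier_vec n" using P x by simp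
  have "x \<bullet> ((transpose_mat P * A * P) *\<^sub>v x) = (P *\<^sub>v x) \<bullet> (A *\<^sub>v (P *\<^sub>v x))"
    using scalar_prod_mult_mat_vec_transpose[OF P x mult_mat_vec_carrier[OF A Px]]
    by (simp add: galerkin_mult_vec[OF x])
  then show ?thesis
    by (simp add: energy_norm_eq_sqrt[OF A spd Px] energy_norm_eq_sqrt[OF galerkin_carrier spdC x])
qed

text \<open>Going through the interpolated vector expresses the coarse bound by fine-level data, so
  that restriction and interpolation errors scale with the \<tau> of the finer level.\<close>

lemma vnorm_le_energy_norm_galerkin:
  assumes x: "x \<in> carrier_vec k"
  shows "vnorm x \<le> sqrt (mat_norm (inv_mat (transpose_mat P * P)) * mat_norm (inv_mat A))
      * energy_norm (transpose_mat P * A * P) x"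
proof -
  have Px: "P *\<^sub>v x \<in> carrier_vec n" using P x by simp
  have "vnorm x \<le> sqrt (mat_norm (inv_mat (transpose_mat P * P))) * vnorm (P *\<^sub>v x)"
    by (rule vnorm_le_interpolation[OF x])
  also have "\<dots> \<le> sqrt (mat_norm (inv_mat (transpose_mat P * P)))
      * (sqrt (mat_norm (inv_mat A)) * energy_norm A (P *\<^sub>v x))"
    using mat_norm_nonneg[OF spd_inv_mat(1)[OF gram_carrier spd_gram gram_carrier] k]
    by (intro mult_left_mono vnorm_le_energy_norm[OF A spd Px]) simp
  finally show ?thesis by (simp add: energy_norm_galerkin[OF x] real_sqrt_mult mult_ac)
qed

text \<open>Dual form of the previous bound: the squared energy norm of the coarse solution is its
  scalar product with \<open>e\<close>.\<close>

lemma energy_norm_galerkin_inv_le_vnorm: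
  assumes e: "e \<in> carrier_vec k"
  shows "energy_norm (transpose_mat P * A * P) (inv_mat (transpose_mat P * A * P) *\<^sub>v e)
    \<le> sqrt (mat_norm (inv_mat (transpose_mat P * P)) * mat_norm (inv_mat A)) * vnorm e"
    (is "energy_norm ?C ?w \<le> ?c * _")
proof (cases "?w = 0\<^sub>v k")
  case True
  then show ?thesis
    using energy_norm_zero[OF galerkin_carrier spdC] mat_norm_nonneg[OF spd_inv_mat(1)[OF A spd A] n]
      mat_norm_nonneg[OF spd_inv_mat(1)[OF gram_carrier spd_gram gram_carrier] k]
    by simp
next
  case False
  note I = spd_inv_mat_mult_vec[OF spdC galerkin_carrier e]
  have "energy_norm ?C ?w * energy_norm ?C ?w = ?w \<bullet> e"
    using energy_norm_power2[OF galerkin_carrier spdC I(3)] I(1) by (simp add: power2_eq_square)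
  also have "\<dots> \<le> vnorm ?w * vnorm e" using abs_scalar_prod_le[OF I(3) e] by simp
  also have "\<dots> \<le> (?c * energy_norm ?C ?w) * vnorm e"
    by (intro mult_right_mono vnorm_le_energy_norm_galerkin[OF I(3)]) simp
  finally have "energy_norm ?C ?w * energy_norm ?C ?w \<le> energy_norm ?C ?w * (?c * vnorm e)"
    by (simp add: mult_ac)
  moreover have "0 < energy_norm ?C ?w" using energy_norm_pos[OF galerkin_carrier spdC I(3) False] .
  ultimately show ?thesis by (rule mult_left_le_imp_le)
qed

text \<open>Interpolated, the left-hand vector is the energy-orthogonal projection of \<open>z\<close>.\<close>
lemma energy_norm_coarse_solution_le:
  assumes z: "z \<in> carrier_vec n"
  shows "energy_norm (transpose_mat P * A * P)
      (inv_mat (transpose_mat P * A * P) *\<^sub>v (transpose_mat P *\<^sub>v (A *\<^sub>v z))) \<le> energy_norm A z"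
    (is "energy_norm ?C ?w \<le> _")
proof (cases "?w = 0\<^sub>v k")
  case True
  then show ?thesis using energy_norm_zero[OF galerkin_carrier spdC] by simp
next
  case False
  have Az: "A *\<^sub>v z \<in> carrier_vec n" using A z by simp
  have t: "transpose_mat P *\<^sub>v (A *\<^sub>v z) \<in> carrier_vec k" using P Az by simp
  note I = spd_inv_mat_mult_vec[OF spdC galerkin_carrier t]
  have Pw: "P *\<^sub>v ?w \<in> carrier_vec n" using P I(3) by simp
  have "energy_norm ?C ?w * energy_norm ?C ?w = ?w \<bullet> (transpose_mat P *\<^sub>v (A *\<^sub>v z))"
    using energy_norm_power2[OF galerkin_carrier spdC I(3)] I(1) by (simp add: power2_eq_square)
  also have "\<dots> = (P *\<^sub>v ?w) \<bullet> (A *\<^sub>v z)"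
    using scalar_prod_mult_mat_vec_transpose[OF P I(3) Az] by simp
  also have "\<dots> \<le> energy_norm ?C ?w * energy_norm A z"
    using energy_norm_Cauchy_Schwarz[OF A spd Pw z] by (simp add: energy_norm_galerkin[OF I(3)])
  finally show ?thesis
    using energy_norm_pos[OF galerkin_carrier spdC I(3) False] by (rule mult_left_le_imp_le)
qed

end

section \<open>One level of the cycle\<close>

text \<open>\<open>S\<close> collects the errors of one level before the final rounding, which costs \<open>\<tau> (2 + S)\<close>. The
  right-hand side is \<open>2 \<tau> + (1 + \<tau>) (2 \<tau> + \<mu> (2 + \<beta> + 2 \<tau>))\<close>, so it suffices to bound \<open>S\<close> by
  \<open>2 \<tau> + \<mu> (2 + \<beta>)\<close>.\<close>
lemma step_budget:
  fixes \<tau> \<sigma> K \<mu> :: real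
  assumes nn: "0 \<le> \<tau>" "0 \<le> \<sigma>" "0 \<le> K" and \<tau>\<mu>: "3 * \<tau> \<le> \<mu>" and small: "\<mu> * (4 + 3 * \<sigma> + 2 * K) \<le> 1"
    and X: "X = 1 + \<tau> + \<sigma> * \<tau> + 2 * K * \<tau>"
    and S: "S = 2 * \<tau> + 3 * \<sigma> * \<tau> + 4 * K * \<tau> + 2 * \<mu> * X + 2 / 3 * \<mu> * (X + \<mu> * X)"
    and \<beta>: "\<beta> = 2 + 3 * \<sigma> + 2 * K"
  shows "S + \<tau> * (2 + S) \<le> 4 * \<tau> + (2 + \<beta>) * \<mu> + 2 * \<tau>\<^sup>2 + (4 + \<beta>) * \<mu> * \<tau> + 2 * \<mu> * \<tau>\<^sup>2"
proof -
  have \<mu>: "0 \<le> \<mu>" using nn \<tau>\<mu> by simp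
  have m1: "0 \<le> \<sigma> * \<mu>" "0 \<le> K * \<mu>" "0 \<le> \<sigma> * \<tau>" "0 \<le> K * \<tau>" using nn \<mu> by simp_all
  have m2: "3 * (\<sigma> * \<tau>) \<le> \<sigma> * \<mu>" "3 * (K * \<tau>) \<le> K * \<mu>"
    using mult_left_mono[OF \<tau>\<mu> nn(2)] mult_left_mono[OF \<tau>\<mu> nn(3)] by simp_all
  have sm: "4 * \<mu> + 3 * (\<sigma> * \<mu>) + 2 * (K * \<mu>) \<le> 1" using small by (simp add: algebra_simps)
  \<comment> \<open>As \<tau> is at most \<mu> / 3, the terms of \<open>X\<close> beyond 1 are at
    most a third of \<mu> (1 + \<sigma> + 2 K), which \<open>sm\<close> bounds by 1.\<close>
  have X1: "X \<le> 4 / 3" "0 \<le> X" using m1 m2 sm \<tau>\<mu> nn unfolding X by linarith+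
  have \<mu>4: "\<mu> \<le> 1 / 4" using sm m1 by simp
  have "\<mu> * X \<le> 1 / 4 * (4 / 3)" using \<mu>4 X1 \<mu> by (intro mult_mono) auto
  moreover have "2 * X + 2 / 3 * (X + \<mu> * X) = 8 / 3 * X + 2 / 3 * (\<mu> * X)" by (simp add: field_simps)
  \<comment> \<open>The two bounds give at most 32/9 + 2/9 = 34/9.\<close>
  ultimately have "2 * X + 2 / 3 * (X + \<mu> * X) \<le> 4" using X1 by linarith
  then have "\<mu> * (2 * X + 2 / 3 * (X + \<mu> * X)) \<le> \<mu> * 4" using \<mu> by (intro mult_left_mono)
  then have "2 * \<mu> * X + 2 / 3 * \<mu> * (X + \<mu> * X) \<le> 4 * \<mu>" by (simp add: algebra_simps)
  \<comment> \<open>Here 2 + \<beta> is 4 + 3 \<sigma> + 2 K. The 4 pays for the terms with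
    \<open>X\<close>, while \<open>m2\<close> puts the \<sigma> and K terms within 3 \<sigma> \<mu>
    and 2 K \<mu>.\<close>
  then have S1: "S \<le> 2 * \<tau> + \<mu> * (2 + \<beta>)" using S \<beta> m1 m2 by (simp add: algebra_simps)
  have "S + \<tau> * (2 + S) = 2 * \<tau> + (1 + \<tau>) * S" by (simp add: algebra_simps)
  also have "\<dots> \<le> 2 * \<tau> + (1 + \<tau>) * (2 * \<tau> + \<mu> * (2 + \<beta>))"
    using S1 nn by (intro add_left_mono mult_left_mono) auto
  also have "\<dots> \<le> 2 * \<tau> + (1 + \<tau>) * (2 * \<tau> + \<mu> * (2 + \<beta>)) + 2 * \<mu> * \<tau> + 2 * \<mu> * \<tau>\<^sup>2"
    using \<mu> nn by simp
  also have "\<dots> = 4 * \<tau> + (2 + \<beta>) * \<mu> + 2 * \<tau>\<^sup>2 + (4 + \<beta>) * \<mu> * \<tau> + 2 * \<mu> * \<tau>\<^sup>2"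
    by (simp add: algebra_simps power2_eq_square)
  finally show ?thesis .
qed

section \<open>Rounding of the right-hand side, relaxation and residual on one level\<close>

context
  fixes A M :: "real mat" and n :: nat and \<epsilon> \<alpha> \<sigma> :: real and r e0 e1 :: "real vec"
  assumes A: "A \<in> carrier_mat n n" and spd: "spd_mat A" and n: "0 < n"
    and M: "M \<in> carrier_mat n n" and \<epsilon>: "0 < \<epsilon>" "\<epsilon> < 1"
    and \<sigma>: "(1 + \<epsilon>) * (\<alpha> * mat_norm A) \<le> \<sigma>" "(1 + \<epsilon>) * (\<alpha> * mat_norm (abs_mat A)) \<le> \<sigma>"
      "(1 + \<epsilon>) * (mat_norm (abs_mat A) * mat_norm M) \<le> \<sigma>"
    and r: "r \<in> carrier_vec n"
    and e0: "e0 \<in> carrier_vec n" "vnorm e0 \<le> \<epsilon> * vnorm r"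
    and e1: "e1 \<in> carrier_vec n" "vnorm e1 \<le> \<alpha> * \<epsilon> * vnorm (r + e0)"
begin

lemma abs_mat_carrier: "abs_mat A \<in> carrier_mat n n"
  using A by (simp add: abs_mat_def)

lemma sigma_nonneg: "0 \<le> \<sigma>"
  using \<sigma>(3) mat_norm_nonneg[OF abs_mat_carrier n] mat_norm_nonneg[OF M n] \<epsilon>
  by (intro order_trans[OF _ \<sigma>(3)]) simp

lemma rounded_rhs_norm: "vnorm (r + e0) \<le> (1 + \<epsilon>) * vnorm r"
  using vnorm_triangle[OF r e0(1)] e0(2) by (simp add: algebra_simps)

text \<open>Nothing excludes a negative \<open>\<alpha>\<close>, hence the maximum.\<close>
lemma relax_rounding_norm: "vnorm e1 \<le> max 0 \<alpha> * \<epsilon> * vnorm (r + e0)"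
  using e1(2) \<epsilon> by (elim order_trans) (intro mult_right_mono, auto)

lemma max_alpha_bound:
  assumes "(1 + \<epsilon>) * (\<alpha> * b) \<le> \<sigma>" shows "(1 + \<epsilon>) * (max 0 \<alpha> * b) \<le> \<sigma>"
  using assms sigma_nonneg by (simp add: max_def)

lemma sqrt_cond_num: "sqrt (cond_num A) = sqrt (mat_norm (inv_mat A)) * sqrt (mat_norm A)"
  by (simp add: cond_num_def real_sqrt_mult)

text \<open>Pulling \<open>e\<close> back costs the square root of the norm of the inverse, and
  estimating \<open>r\<close>, which is \<open>A\<close> applied to the solution, that of the norm
  of \<open>A\<close>. Together they produce the square root of the condition number.\<close>

lemma energy_norm_inv_of_relative:
  assumes e: "e \<in> carrier_vec n" "vnorm e \<le> c * vnorm r" and c: "0 \<le> c"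
  shows "energy_norm A (inv_mat A *\<^sub>v e) \<le> sqrt (cond_num A) * c * energy_norm A (inv_mat A *\<^sub>v r)"
proof -
  let ?x = "inv_mat A *\<^sub>v r"
  note x = spd_inv_mat_mult_vec[OF spd A r]
  have i0: "0 \<le> mat_norm (inv_mat A)" using mat_norm_nonneg[OF spd_inv_mat(1)[OF A spd A] n] .
  have "energy_norm A (inv_mat A *\<^sub>v e) \<le> sqrt (mat_norm (inv_mat A)) * vnorm e"
    by (rule energy_norm_inv_le_vnorm[OF A spd e(1)])
  also have "\<dots> \<le> sqrt (mat_norm (inv_mat A)) * (c * vnorm r)"
    using i0 e(2) by (intro mult_left_mono) simp_all
  also have "\<dots> \<le> sqrt (mat_norm (inv_mat A)) * (c * (sqrt (mat_norm A) * energy_norm A ?x))"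
    using i0 c vnorm_mult_le_energy_norm[OF A spd x(3)] x(1) by (intro mult_left_mono) simp_all
  finally show ?thesis by (simp add: sqrt_cond_num mult_ac)
qed

lemma energy_norm_rhs_rounding:
  "energy_norm A (inv_mat A *\<^sub>v e0) \<le> sqrt (cond_num A) * \<epsilon> * energy_norm A (inv_mat A *\<^sub>v r)"
  using energy_norm_inv_of_relative[OF e0] \<epsilon> by simp

lemma eps_le_tau: "\<epsilon> \<le> sqrt (cond_num A) * \<epsilon>"
  using cond_num_spd_ge_1[OF A spd n] \<epsilon> by simp

text \<open>This error lies in solution space, so both conversions contribute
  \<open>sqrt (mat_norm A)\<close>. Their product \<open>mat_norm A\<close> is absorbed by \<sigma>,
  and only \<open>eps_le_tau\<close> brings the result to the scale of \<tau>.\<close>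

lemma energy_norm_relax_rounding:
  "energy_norm A e1 \<le> \<sigma> * (sqrt (cond_num A) * \<epsilon>) * energy_norm A (inv_mat A *\<^sub>v r)"
proof -
  let ?x = "inv_mat A *\<^sub>v r"
  note x = spd_inv_mat_mult_vec[OF spd A r]
  have a0: "0 \<le> mat_norm A" by (rule mat_norm_nonneg[OF A n])
  let ?a = "max 0 \<alpha>"
  have "energy_norm A e1 \<le> sqrt (mat_norm A) * vnorm e1"
    by (rule energy_norm_le_vnorm[OF A spd e1(1)])
  also have "\<dots> \<le> sqrt (mat_norm A) * (?a * \<epsilon> * vnorm (r + e0))"
    using a0 relax_rounding_norm by (intro mult_left_mono) simp_all
  also have "\<dots> \<le> sqrt (mat_norm A) * (?a * \<epsilon> * ((1 + \<epsilon>) * (sqrt (mat_norm A) * energy_norm A ?x)))"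
  proof (intro mult_left_mono)
    have "vnorm r \<le> sqrt (mat_norm A) * energy_norm A ?x"
      using vnorm_mult_le_energy_norm[OF A spd x(3)] x(1) by simp
    then show "vnorm (r + e0) \<le> (1 + \<epsilon>) * (sqrt (mat_norm A) * energy_norm A ?x)"
      using \<epsilon> by (intro order_trans[OF rounded_rhs_norm] mult_left_mono) auto
  qed (use a0 \<epsilon> in auto)
  also have "\<dots> = ((1 + \<epsilon>) * (?a * mat_norm A)) * \<epsilon> * energy_norm A ?x"
    (is "_ = ?rhs")
  proof -
    have "sqrt (mat_norm A) * (?a * \<epsilon> * ((1 + \<epsilon>) * (sqrt (mat_norm A) * energy_norm A ?x)))
      = (sqrt (mat_norm A) * sqrt (mat_norm A)) * ((1 + \<epsilon>) * ?a * \<epsilon> * energy_norm A ?x)"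
      by (simp only: mult_ac)
    also have "\<dots> = ?rhs" using a0 by (simp add: mult_ac)
    finally show ?thesis .
  qed
  also have "\<dots> \<le> \<sigma> * (sqrt (cond_num A) * \<epsilon>) * energy_norm A ?x"
    using max_alpha_bound[OF \<sigma>(1)] sigma_nonneg eps_le_tau \<epsilon> by (intro mult_right_mono mult_mono) auto
  finally show ?thesis .
qed

lemma relaxed_rhs_norm:
  "vnorm (abs_vec (r + e0) + abs_mat A *\<^sub>v abs_vec (M *\<^sub>v (r + e0) + e1)) \<le> 2 * (1 + \<sigma>) * vnorm r"
proof -
  let ?r0 = "r + e0" and ?y = "M *\<^sub>v (r + e0) + e1"
  let ?a = "mat_norm (abs_mat A)" and ?b = "max 0 \<alpha>"
  have r0: "?r0 \<in> carrier_vec n" using r e0 by simp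
  have y: "?y \<in> carrier_vec n" using M r0 e1 by simp
  have a0: "0 \<le> ?a" by (rule mat_norm_nonneg[OF abs_mat_carrier n])
  have "vnorm ?y \<le> vnorm (M *\<^sub>v ?r0) + vnorm e1"
    using M r0 e1 by (intro vnorm_triangle[of _ n]) auto
  also have "\<dots> \<le> mat_norm M * vnorm ?r0 + ?b * \<epsilon> * vnorm ?r0"
    by (intro add_mono vnorm_mult_mat_vec_le[OF M r0] relax_rounding_norm)
  finally have yn: "vnorm ?y \<le> (mat_norm M + ?b * \<epsilon>) * vnorm ?r0" by (simp add: algebra_simps)
  have "vnorm (abs_vec ?r0 + abs_mat A *\<^sub>v abs_vec ?y) \<le> vnorm (abs_vec ?r0) + vnorm (abs_mat A *\<^sub>v abs_vec ?y)"
    using abs_mat_carrier r0 y by (intro vnorm_triangle[of _ n]) auto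
  also have "\<dots> \<le> vnorm ?r0 + ?a * vnorm ?y"
    using vnorm_mult_mat_vec_le[OF abs_mat_carrier, of "abs_vec ?y"] y by simp
  also have "\<dots> \<le> vnorm ?r0 + ?a * ((mat_norm M + ?b * \<epsilon>) * vnorm ?r0)"
    using a0 yn by (intro add_left_mono mult_left_mono)
  also have "\<dots> = (1 + ?a * (mat_norm M + ?b * \<epsilon>)) * vnorm ?r0" by (simp add: algebra_simps)
  also have "\<dots> \<le> (1 + ?a * (mat_norm M + ?b * \<epsilon>)) * ((1 + \<epsilon>) * vnorm r)"
    using a0 mat_norm_nonneg[OF M n] \<epsilon> by (intro mult_left_mono rounded_rhs_norm) simp
  \<comment> \<open>Three groups: 1 + \<epsilon> is at most 2, the product with
    \<open>mat_norm M\<close> is at most \<sigma>, and the relaxation error gives another \<sigma>,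
    its extra factor \<epsilon> being at most 1.\<close>
  also have "\<dots> = (1 + \<epsilon> + (1 + \<epsilon>) * (?a * mat_norm M) + \<epsilon> * ((1 + \<epsilon>) * (?b * ?a))) * vnorm r"
    by (simp add: algebra_simps)
  also have "\<dots> \<le> (2 + \<sigma> + 1 * \<sigma>) * vnorm r"
    using \<sigma>(3) max_alpha_bound[OF \<sigma>(2)] sigma_nonneg \<epsilon> a0
    by (intro mult_right_mono add_mono mult_mono) auto
  finally show ?thesis by (simp add: algebra_simps)
qed

lemma energy_norm_residual_rounding:
  assumes mAp: "0 \<le> mAp"
    and e2: "abs_vec e2 \<le> (mAp * \<epsilon>) \<cdot>\<^sub>v (abs_vec (r + e0) + abs_mat A *\<^sub>v abs_vec (M *\<^sub>v (r + e0) + e1))"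
  shows "e2 \<in> carrier_vec n"
    and "energy_norm A (inv_mat A *\<^sub>v e2)
      \<le> 2 * (mAp * (1 + \<sigma>)) * (sqrt (cond_num A) * \<epsilon>) * energy_norm A (inv_mat A *\<^sub>v r)"
proof -
  have "abs_vec (r + e0) + abs_mat A *\<^sub>v abs_vec (M *\<^sub>v (r + e0) + e1) \<in> carrier_vec n"
    using abs_mat_carrier by (intro carrier_vecI) simp
  note e2' = abs_vec_le_smultD[OF e2 this]
  show c: "e2 \<in> carrier_vec n" using e2'(1) mAp \<epsilon> by simp
  have "vnorm e2 \<le> mAp * \<epsilon> * (2 * (1 + \<sigma>) * vnorm r)"
    using mAp \<epsilon> by (intro order_trans[OF e2'(2) mult_left_mono[OF relaxed_rhs_norm]]) auto
  then have "vnorm e2 \<le> (mAp * \<epsilon> * (2 * (1 + \<sigma>))) * vnorm r" by (simp only: mult_ac)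
  from energy_norm_inv_of_relative[OF c this]
  show "energy_norm A (inv_mat A *\<^sub>v e2)
      \<le> 2 * (mAp * (1 + \<sigma>)) * (sqrt (cond_num A) * \<epsilon>) * energy_norm A (inv_mat A *\<^sub>v r)"
    using mAp \<epsilon> sigma_nonneg by (simp add: mult_ac)
qed

lemma relax_eq:
  assumes G: "G = 1\<^sub>m n - M * A" and x: "x \<in> carrier_vec n"
  shows "G *\<^sub>v x = x - M *\<^sub>v (A *\<^sub>v x)"
  using M A x unfolding G
  by (simp add: minus_mult_distrib_mat_vec[where nr=n and nc=n]
      assoc_mult_mat_vec[where ?n\<^sub>1=n and ?n\<^sub>2=n and ?n\<^sub>3=n])

text \<open>Backward view of the first rounding: \<open>r + e0\<close> is the exact right-hand side
  of a shifted solution, and relaxation from zero leaves \<open>G\<close> times that solution as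
  error.\<close>

lemma relaxed_eq:
  assumes G: "G = 1\<^sub>m n - M * A"
  shows "M *\<^sub>v (r + e0) = (inv_mat A *\<^sub>v r + inv_mat A *\<^sub>v e0) - G *\<^sub>v (inv_mat A *\<^sub>v r + inv_mat A *\<^sub>v e0)"
    "A *\<^sub>v (inv_mat A *\<^sub>v r + inv_mat A *\<^sub>v e0) = r + e0"
proof -
  let ?z = "inv_mat A *\<^sub>v r + inv_mat A *\<^sub>v e0"
  note x = spd_inv_mat_mult_vec[OF spd A r] and a = spd_inv_mat_mult_vec[OF spd A e0(1)]
  have z: "?z \<in> carrier_vec n" using x a by simp
  show Az: "A *\<^sub>v ?z = r + e0" using x a by (simp add: mult_add_distrib_mat_vec[OF A x(3) a(3)])
  have "M *\<^sub>v (r + e0) \<in> carrier_vec n" using M r e0 by simp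
  then show "M *\<^sub>v (r + e0) = ?z - G *\<^sub>v ?z" unfolding relax_eq[OF G z] Az using z by (intro eq_vecI) auto
qed

text \<open>By linearity the deviation from the exact relaxation is \<open>a - G *\<^sub>v a\<close>
  plus \<open>e1\<close>. The first part costs 2 \<tau> because \<open>G\<close> does not increase
  the energy norm, the second \<sigma> \<tau>.\<close>

lemma coarsest_level_error:
  assumes G: "G = 1\<^sub>m n - M * A"
    and Gn: "\<And>v. v \<in> carrier_vec n \<Longrightarrow> energy_norm A (G *\<^sub>v v) \<le> energy_norm A v"
  shows "energy_norm A (M *\<^sub>v (r + e0) + e1 - (inv_mat A *\<^sub>v r - G *\<^sub>v (inv_mat A *\<^sub>v r)))
    \<le> (2 + \<sigma>) * (sqrt (cond_num A) * \<epsilon>) * energy_norm A (inv_mat A *\<^sub>v r)"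
proof -
  define x a where "x = inv_mat A *\<^sub>v r" and "a = inv_mat A *\<^sub>v e0"
  have x: "x \<in> carrier_vec n" and a: "a \<in> carrier_vec n"
    using spd_inv_mat_mult_vec(3)[OF spd A] r e0 by (auto simp: x_def a_def)
  have Gc: "G \<in> carrier_mat n n" unfolding G by (rule minus_carrier_mat[OF mult_carrier_mat[OF M A]])
  have c: "G *\<^sub>v x \<in> carrier_vec n" "G *\<^sub>v a \<in> carrier_vec n" using Gc x a by auto
  have "M *\<^sub>v (r + e0) + e1 - (x - G *\<^sub>v x) = (a - G *\<^sub>v a) + e1"
    unfolding relaxed_eq(1)[OF G, folded x_def a_def] mult_add_distrib_mat_vec[OF Gc x a]
    using x a c e1(1) Gc by (intro eq_vecI) auto
  also have "energy_norm A \<dots> \<le> energy_norm A (a - G *\<^sub>v a) + energy_norm A e1"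
    using a c e1(1) by (intro energy_norm_triangle[OF A spd]) auto
  also have "\<dots> \<le> energy_norm A a + energy_norm A a + energy_norm A e1"
    using energy_norm_triangle_minus[OF A spd a c(2)] Gn[OF a] by simp
  also have "\<dots> \<le> (2 + \<sigma>) * (sqrt (cond_num A) * \<epsilon>) * energy_norm A x"
    using energy_norm_rhs_rounding energy_norm_relax_rounding by (simp add: a_def x_def algebra_simps)
  finally show ?thesis by (simp only: x_def)
qed

end

text \<open>The induction step with the level indices stripped off: \<open>V\<close> and
  \<open>Vf\<close> are the exact error operators of the coarse and the fine cycle, tied together by
  \<open>Vf_eq\<close>, and \<open>ih\<close> is the induction hypothesis. Each error is carried
  through these linear operators, so that the exact contributions recombine to \<open>Vf\<close> and
  only the local errors and the inherited one remain.\<close>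

lemma two_level_error:
  fixes A M P V Vf C G :: "real mat"
  assumes A: "A \<in> carrier_mat n n" and spd: "spd_mat A" and n: "0 < n"
    and M: "M \<in> carrier_mat n n" and \<epsilon>: "0 < \<epsilon>" "\<epsilon> < 1"
    and \<sigma>: "(1 + \<epsilon>) * (\<alpha> * mat_norm A) \<le> \<sigma>" "(1 + \<epsilon>) * (\<alpha> * mat_norm (abs_mat A)) \<le> \<sigma>"
      "(1 + \<epsilon>) * (mat_norm (abs_mat A) * mat_norm M) \<le> \<sigma>"
    and r: "r \<in> carrier_vec n"
    and e0: "e0 \<in> carrier_vec n" "vnorm e0 \<le> \<epsilon> * vnorm r"
    and e1: "e1 \<in> carrier_vec n" "vnorm e1 \<le> \<alpha> * \<epsilon> * vnorm (r + e0)"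
    and P: "P \<in> carrier_mat n k" and k: "0 < k"
    and C: "C = transpose_mat P * A * P" and spdC: "spd_mat C"
    and G: "G = 1\<^sub>m n - M * A"
    and G_le: "\<And>v. v \<in> carrier_vec n \<Longrightarrow> energy_norm A (G *\<^sub>v v) \<le> energy_norm A v"
    and V: "V \<in> carrier_mat k k"
    and V_le: "\<And>c. c \<in> carrier_vec k \<Longrightarrow> energy_norm C (V *\<^sub>v c) \<le> \<rho> * energy_norm C c"
    and Vf: "Vf \<in> carrier_mat n n"
    and Vf_le: "\<And>v. v \<in> carrier_vec n \<Longrightarrow> energy_norm A (Vf *\<^sub>v v) \<le> \<rho> * energy_norm A v"
    and Vf_eq: "\<And>v w. v \<in> carrier_vec n \<Longrightarrow>
        w = inv_mat C *\<^sub>v (transpose_mat P *\<^sub>v (A *\<^sub>v (G *\<^sub>v v))) \<Longrightarrow>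
        Vf *\<^sub>v v = G *\<^sub>v v - P *\<^sub>v (w - V *\<^sub>v w)"
    and \<rho>: "0 \<le> \<rho>" and \<delta>c: "0 \<le> \<delta>c" and \<rho>\<delta>: "\<rho> + \<delta>c \<le> 1"
    and mAp: "0 \<le> mAp"
    and yh: "yh = M *\<^sub>v (r + e0) + e1"
    and e2: "abs_vec e2 \<le> (mAp * \<epsilon>) \<cdot>\<^sub>v (abs_vec (r + e0) + abs_mat A *\<^sub>v abs_vec yh)"
    and s: "s = A *\<^sub>v yh - (r + e0) + e2"
    and c3: "0 \<le> c3" and e3: "abs_vec e3 \<le> c3 \<cdot>\<^sub>v (transpose_mat P *\<^sub>v abs_vec s)"
    and rc: "rc = transpose_mat P *\<^sub>v s + e3"
    and dc: "dc \<in> carrier_vec k"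
    and ih: "energy_norm C (dc - (inv_mat C *\<^sub>v rc - V *\<^sub>v (inv_mat C *\<^sub>v rc)))
        \<le> \<delta>c * energy_norm C (inv_mat C *\<^sub>v rc)"
    and c4: "0 \<le> c4" and e4: "abs_vec e4 \<le> c4 \<cdot>\<^sub>v (P *\<^sub>v abs_vec dc)"
    and d: "d = P *\<^sub>v dc + e4"
    and e5: "\<forall>i<n. \<bar>e5 $ i\<bar> \<le> \<epsilon>"
    and y: "y = vec n (\<lambda>i. (yh $ i - d $ i) * (1 + e5 $ i))"
    and \<mu>3: "c3 * sqrt (cond_num (transpose_mat P * P)) * sqrt (cond_num A) \<le> \<mu>"
    and \<mu>4: "c4 * sqrt (cond_num (transpose_mat P * P)) * sqrt (cond_num A) \<le> \<mu> / 3"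
    and \<tau>: "\<tau> = sqrt (cond_num A) * \<epsilon>"
    and \<tau>\<mu>: "3 * \<tau> \<le> \<mu>" and small: "\<mu> * (2 + beta \<sigma> mAp) \<le> 1"
  shows "energy_norm A (y - (inv_mat A *\<^sub>v r - Vf *\<^sub>v (inv_mat A *\<^sub>v r)))
    \<le> (\<delta>c + (4 * \<tau> + (2 + beta \<sigma> mAp) * \<mu> + 2 * \<tau>\<^sup>2 + (4 + beta \<sigma> mAp) * \<mu> * \<tau> + 2 * \<mu> * \<tau>\<^sup>2))
      * energy_norm A (inv_mat A *\<^sub>v r)"
proof -
  note ctxt = A spd n M \<epsilon> \<sigma> r e0 e1
  have spdPAP: "spd_mat (transpose_mat P * A * P)" using spdC C by simp
  note cctxt = A spd P n k spdPAP
  note tri = energy_norm_triangle[OF A spd] and trim = energy_norm_triangle_minus[OF A spd]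
  have Cc: "C \<in> carrier_mat k k" using galerkin_carrier[OF cctxt] C by simp
  note ctri = energy_norm_triangle[OF Cc spdC] and ctrim = energy_norm_triangle_minus[OF Cc spdC]
  note Ic = spd_inv_mat(1)[OF Cc spdC Cc]
  have Gc: "G \<in> carrier_mat n n" unfolding G by (rule minus_carrier_mat[OF mult_carrier_mat[OF M A]])
  have Pt: "transpose_mat P \<in> carrier_mat k n" using P by simp
  let ?en = "energy_norm A" and ?ec = "energy_norm C"
  have \<sigma>0: "0 \<le> \<sigma>" by (rule sigma_nonneg[OF ctxt])
  define K where "K = mAp * (1 + \<sigma>)"
  have K0: "0 \<le> K" using mAp \<sigma>0 by (simp add: K_def)
  have \<beta>: "beta \<sigma> mAp = 2 + 3 * \<sigma> + 2 * K" by (simp add: beta_def K_def)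
  have \<tau>0: "0 \<le> \<tau>" using \<tau> cond_num_spd_ge_1[OF A spd n] \<epsilon> by simp
  have \<mu>0: "0 \<le> \<mu>" using \<tau>\<mu> \<tau>0 by simp
  define sc where "sc v = inv_mat C *\<^sub>v (transpose_mat P *\<^sub>v (A *\<^sub>v v))" for v
  have scc: "sc v \<in> carrier_vec k" if "v \<in> carrier_vec n" for v using that A Pt Ic by (simp add: sc_def)
  have sc_le: "?ec (sc v) \<le> ?en v" if "v \<in> carrier_vec n" for v
    using energy_norm_coarse_solution_le[OF cctxt that] by (simp add: sc_def C)

  define x where "x = inv_mat A *\<^sub>v r"
  define a0 where "a0 = inv_mat A *\<^sub>v e0"
  define a2 where "a2 = inv_mat A *\<^sub>v e2"
  have e2c: "e2 \<in> carrier_vec n"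
    using energy_norm_residual_rounding(1)[OF ctxt mAp] e2 yh by simp
  have xc: "x \<in> carrier_vec n" and a0c: "a0 \<in> carrier_vec n" and a2c: "a2 \<in> carrier_vec n"
    using spd_inv_mat_mult_vec(3)[OF spd A] r e0 e2c by (auto simp: x_def a0_def a2_def)
  have Aa2: "A *\<^sub>v a2 = e2" using spd_inv_mat_mult_vec(1)[OF spd A e2c] by (simp add: a2_def)
  define N where "N = ?en x"
  have N0: "0 \<le> N" by (simp add: N_def)
  have a0n: "?en a0 \<le> \<tau> * N"
    using energy_norm_rhs_rounding[OF ctxt] by (simp add: a0_def x_def N_def \<tau>)
  have e1n: "?en e1 \<le> \<sigma> * \<tau> * N"
    using energy_norm_relax_rounding[OF ctxt] by (simp add: x_def N_def \<tau>)
  have a2n: "?en a2 \<le> 2 * K * \<tau> * N"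
    using energy_norm_residual_rounding(2)[OF ctxt mAp] e2 yh by (simp add: x_def N_def a2_def \<tau> K_def)
  \<comment> \<open>The exact solution for the rounded right-hand side.\<close>
  define z where "z = x + a0"
  have zc: "z \<in> carrier_vec n" using xc a0c by (simp add: z_def)
  define Gz where "Gz = G *\<^sub>v z"
  have Gzc: "Gz \<in> carrier_vec n" using Gc zc by (simp add: Gz_def)
  have Gzn: "?en Gz \<le> N + \<tau> * N"
    using G_le[OF zc] tri[OF xc a0c] a0n by (simp add: Gz_def z_def N_def)
  have yh_eq: "yh = z - Gz + e1" and Az: "A *\<^sub>v z = r + e0"
    using relaxed_eq[OF ctxt G] by (simp_all add: yh z_def x_def a0_def Gz_def)
  define q where "q = e1 + a2"
  have qc: "q \<in> carrier_vec n" using e1 a2c by (simp add: q_def)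
  have qn: "?en q \<le> \<sigma> * \<tau> * N + 2 * K * \<tau> * N" using tri[OF e1(1) a2c] e1n a2n by (simp add: q_def)
  define X where "X = 1 + \<tau> + \<sigma> * \<tau> + 2 * K * \<tau>"
  have X0: "0 \<le> X" using \<tau>0 \<sigma>0 K0 by (simp add: X_def)

  \<comment> \<open>The energy-space preimage of the computed residual: it equals
    \<open>yh - z\<close> plus the pulled-back residual error \<open>a2\<close>.\<close>
  define u where "u = q - Gz"
  have uc: "u \<in> carrier_vec n" using qc Gzc by (simp add: u_def)
  have un: "?en u \<le> X * N"
    using trim[OF qc Gzc] qn Gzn by (simp add: u_def X_def algebra_simps)
  have s_eq: "s = A *\<^sub>v u"
  proof -
    have yhc: "yh \<in> carrier_vec n" using zc Gzc e1 by (simp add: yh_eq)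
    have "u = (yh - z) + a2" unfolding u_def q_def yh_eq using zc Gzc e1 a2c by (intro eq_vecI) auto
    then have "A *\<^sub>v u = (A *\<^sub>v yh - A *\<^sub>v z) + e2"
      using A yhc zc a2c Aa2
      by (simp add: mult_add_distrib_mat_vec[where nr=n and nc=n] mult_minus_distrib_mat_vec[where nr=n and nc=n])
    then show ?thesis by (simp add: s Az)
  qed
  have sc': "s \<in> carrier_vec n" using A uc by (simp add: s_eq)
  let ?Q = "transpose_mat P * P"
  let ?q = "mat_norm ?Q" and ?qi = "mat_norm (inv_mat ?Q)" and ?a = "mat_norm A" and ?ai = "mat_norm (inv_mat A)"
  have qq0: "0 \<le> ?q" "0 \<le> ?qi" "0 \<le> ?a" "0 \<le> ?ai"
    using mat_norm_nonneg[OF gram_carrier[OF cctxt] k] mat_norm_nonneg[OF A n]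
      mat_norm_nonneg[OF spd_inv_mat(1)[OF A spd A] n]
      mat_norm_nonneg[OF spd_inv_mat(1)[OF gram_carrier[OF cctxt] spd_gram[OF cctxt] gram_carrier[OF cctxt]] k]
    by auto
  \<comment> \<open>The same four square roots meet in the restriction bound and in the
    interpolation bound.\<close>
  have kap: "sqrt (?qi * ?ai) * (sqrt ?q * sqrt ?a) = sqrt (cond_num ?Q) * sqrt (cond_num A)"
    by (simp add: cond_num_def real_sqrt_mult mult_ac)

  define b3 where "b3 = inv_mat C *\<^sub>v e3"
  have e3p: "e3 \<in> carrier_vec k" "vnorm e3 \<le> c3 * vnorm (transpose_mat P *\<^sub>v abs_vec s)"
    using abs_vec_le_smultD[OF e3 _ c3, of k] Pt sc' by auto
  have b3c: "b3 \<in> carrier_vec k" using Ic e3p by (simp add: b3_def)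
  have b3n: "?ec b3 \<le> \<mu> * (X * N)"
  proof -
    have "vnorm e3 \<le> c3 * (sqrt ?q * vnorm s)"
      using e3p(2) vnorm_restriction_le[OF cctxt, of "abs_vec s"] sc' c3
      by (auto elim!: order_trans intro: mult_left_mono)
    also have "\<dots> \<le> c3 * (sqrt ?q * (sqrt ?a * ?en u))"
      using vnorm_mult_le_energy_norm[OF A spd uc] c3 qq0
      unfolding s_eq by (intro mult_left_mono) auto
    finally have 1: "vnorm e3 \<le> c3 * (sqrt ?q * (sqrt ?a * ?en u))" .
    have "?ec b3 \<le> sqrt (?qi * ?ai) * vnorm e3"
      using energy_norm_galerkin_inv_le_vnorm[OF cctxt e3p(1)] by (simp add: b3_def C)
    also have "\<dots> \<le> sqrt (?qi * ?ai) * (c3 * (sqrt ?q * (sqrt ?a * ?en u)))"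
      using 1 qq0 by (intro mult_left_mono) auto
    also have "\<dots> = c3 * (sqrt (?qi * ?ai) * (sqrt ?q * sqrt ?a)) * ?en u" by (simp only: mult_ac)
    also have "\<dots> = (c3 * sqrt (cond_num ?Q) * sqrt (cond_num A)) * ?en u" unfolding kap by (simp only: mult_ac)
    also have "\<dots> \<le> \<mu> * (X * N)" using \<mu>3 un \<mu>0 by (intro mult_mono) auto
    finally show ?thesis .
  qed

  \<comment> \<open>The coarse solution is split as \<open>w = w' - g\<close>. The part
    \<open>g\<close> belongs to the exact cycle started from \<open>z\<close>, while
    \<open>w'\<close> collects the pulled-back local errors. The residual is computed as
    \<open>A\<close> y - r, hence the minus sign and the later subtraction of the
    correction.\<close>
  define w' where "w' = sc q + b3"
  define g where "g = sc Gz"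
  define w where "w = w' - g"
  have w'c: "w' \<in> carrier_vec k" and gc: "g \<in> carrier_vec k" using scc[OF qc] scc[OF Gzc] b3c
    by (auto simp: w'_def g_def)
  have wc: "w \<in> carrier_vec k" using w'c gc by (simp add: w_def)
  have w_eq: "inv_mat C *\<^sub>v rc = w"
  proof -
    have Au: "A *\<^sub>v u = A *\<^sub>v q - A *\<^sub>v Gz" unfolding u_def by (rule mult_minus_distrib_mat_vec[OF A qc Gzc])
    have "transpose_mat P *\<^sub>v (A *\<^sub>v u) = transpose_mat P *\<^sub>v (A *\<^sub>v q) - transpose_mat P *\<^sub>v (A *\<^sub>v Gz)"
      unfolding Au using A qc Gzc by (intro mult_minus_distrib_mat_vec[OF Pt]) auto
    then have "inv_mat C *\<^sub>v (transpose_mat P *\<^sub>v (A *\<^sub>v u)) = sc q - sc Gz"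
      unfolding sc_def using A Pt qc Gzc by (simp add: mult_minus_distrib_mat_vec[OF Ic])
    then have "inv_mat C *\<^sub>v rc = (sc q - sc Gz) + b3"
      unfolding rc s_eq b3_def using A Pt uc e3p by (simp add: mult_add_distrib_mat_vec[OF Ic])
    also have "\<dots> = w" unfolding w_def w'_def g_def using scc[OF qc] scc[OF Gzc] b3c by (intro eq_vecI) auto
    finally show ?thesis .
  qed
  have w'n: "?ec w' \<le> \<sigma> * \<tau> * N + 2 * K * \<tau> * N + \<mu> * (X * N)"
    using ctri[OF scc[OF qc] b3c] sc_le[OF qc] qn b3n by (simp add: w'_def)
  \<comment> \<open>Kept split on purpose: multiplied by \<open>\<delta>c\<close>, the summand
    \<open>N\<close> is the inherited error, while the others join the terms with factor 1 + \<rho>.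
    The unsplit bound \<open>wn'\<close> is enough for the interpolation error.\<close>
  have wn: "?ec w \<le> ?ec w' + (N + \<tau> * N)"
    using ctrim[OF w'c gc] sc_le[OF Gzc] Gzn by (simp add: w_def g_def)
  have wn': "?ec w \<le> (X + \<mu> * X) * N" using wn w'n by (simp add: X_def algebra_simps)

  define ec where "ec = dc - (w - V *\<^sub>v w)"
  have Vwc: "V *\<^sub>v w \<in> carrier_vec k" "V *\<^sub>v w' \<in> carrier_vec k" "V *\<^sub>v g \<in> carrier_vec k"
    using V wc w'c gc by auto
  have ecc: "ec \<in> carrier_vec k" using dc wc Vwc by (simp add: ec_def)
  have ecn: "?ec ec \<le> \<delta>c * ?ec w" using ih by (simp add: w_eq ec_def)
  have dc_eq: "dc = (w - V *\<^sub>v w) + ec" unfolding ec_def using dc wc Vwc V by (intro eq_vecI) auto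
  have dcn: "?ec dc \<le> 2 * ?ec w"
  proof -
    have "?ec dc \<le> ?ec w + \<rho> * ?ec w + \<delta>c * ?ec w"
      unfolding dc_eq using ctri[of "w - V *\<^sub>v w" ec] ctrim[OF wc Vwc(1)] V_le[OF wc] ecn ecc wc Vwc
      by simp
    also have "\<dots> = (1 + (\<rho> + \<delta>c)) * ?ec w" by (simp add: algebra_simps)
    also have "\<dots> \<le> 2 * ?ec w" using \<rho>\<delta> by (intro mult_right_mono) auto
    finally show ?thesis .
  qed
  have e4p: "e4 \<in> carrier_vec n" "vnorm e4 \<le> c4 * vnorm (P *\<^sub>v abs_vec dc)"
    using abs_vec_le_smultD[OF e4 _ c4, of n] P dc by auto
  have e4n: "?en e4 \<le> 2 / 3 * \<mu> * (X + \<mu> * X) * N"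
  proof -
    have "vnorm e4 \<le> c4 * (sqrt ?q * vnorm dc)"
      using e4p(2) vnorm_interpolation_le[OF cctxt, of "abs_vec dc"] dc c4
      by (auto elim!: order_trans intro: mult_left_mono)
    also have "\<dots> \<le> c4 * (sqrt ?q * (sqrt (?qi * ?ai) * ?ec dc))"
      using vnorm_le_energy_norm_galerkin[OF cctxt dc] c4 qq0
      unfolding C by (intro mult_left_mono) auto
    finally have 1: "vnorm e4 \<le> c4 * (sqrt ?q * (sqrt (?qi * ?ai) * ?ec dc))" .
    have "?en e4 \<le> sqrt ?a * vnorm e4" by (rule energy_norm_le_vnorm[OF A spd e4p(1)])
    also have "\<dots> \<le> sqrt ?a * (c4 * (sqrt ?q * (sqrt (?qi * ?ai) * ?ec dc)))"
      using 1 qq0 by (intro mult_left_mono) auto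
    also have "\<dots> = c4 * (sqrt (?qi * ?ai) * (sqrt ?q * sqrt ?a)) * ?ec dc" by (simp only: mult_ac)
    also have "\<dots> = (c4 * sqrt (cond_num ?Q) * sqrt (cond_num A)) * ?ec dc" unfolding kap by (simp only: mult_ac)
    \<comment> \<open>The factor 2 is the bound \<open>dcn\<close> for the computed coarse
      correction, \<mu> / 3 the coefficient of the interpolation rounding.\<close>
    also have "\<dots> \<le> \<mu> / 3 * (2 * ((X + \<mu> * X) * N))"
      using \<mu>4 dcn wn' \<mu>0 by (intro mult_mono) auto
    finally show ?thesis by simp
  qed

  \<comment> \<open>\<open>D c\<close> is the correction that the exact coarse cycle produces when the exact coarse solution is \<open>c\<close>.\<close>
  define D where "D c = P *\<^sub>v (c - V *\<^sub>v c)" for c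
  have Dc: "D c \<in> carrier_vec n" if "c \<in> carrier_vec k" for c using that P V by (simp add: D_def)
  have Dn: "?en (D c) \<le> (1 + \<rho>) * ?ec c" if c: "c \<in> carrier_vec k" for c
  proof -
    have Vc: "V *\<^sub>v c \<in> carrier_vec k" using V c by simp
    have "?en (D c) = ?ec (c - V *\<^sub>v c)"
      unfolding D_def C using energy_norm_galerkin[OF cctxt, of "c - V *\<^sub>v c"] c Vc by simp
    also have "\<dots> \<le> ?ec c + \<rho> * ?ec c" using ctrim[OF c Vc] V_le[OF c] by simp
    finally show ?thesis by (simp add: algebra_simps)
  qed
  have Dw: "D w = D w' - D g"
  proof -
    have "V *\<^sub>v w = V *\<^sub>v w' - V *\<^sub>v g" unfolding w_def by (rule mult_minus_distrib_mat_vec[OF V w'c gc])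
    then have "w - V *\<^sub>v w = (w' - V *\<^sub>v w') - (g - V *\<^sub>v g)"
      unfolding w_def using w'c gc Vwc V by (intro eq_vecI) auto
    then show ?thesis unfolding D_def using P w'c gc Vwc
      by (simp add: mult_minus_distrib_mat_vec[where nr=n and nc=k])
  qed
  have Pec: "P *\<^sub>v ec \<in> carrier_vec n" using P ecc by simp
  have Pdc: "P *\<^sub>v dc = D w + P *\<^sub>v ec"
    unfolding D_def using P wc Vwc ecc arg_cong[OF dc_eq, of "\<lambda>v. P *\<^sub>v v"]
    by (simp add: mult_add_distrib_mat_vec[where nr=n and nc=k])
  have Pecn: "?en (P *\<^sub>v ec) \<le> \<delta>c * ?ec w"
    using energy_norm_galerkin[OF cctxt ecc] ecn by (simp add: C)

  \<comment> \<open>\<open>Vf\<close> at \<open>z\<close> is evaluated in two ways, by the cycle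
    recursion and by linearity. Equating them makes the exact parts of \<open>yh - d\<close>
    collapse to \<open>t\<close> and \<open>a0 - Vf *\<^sub>v a0\<close>.\<close>
  have Vz: "Vf *\<^sub>v z = Gz - D g"
    using Vf_eq[OF zc refl] by (simp add: D_def g_def sc_def Gz_def)
  have Vz': "Vf *\<^sub>v z = Vf *\<^sub>v x + Vf *\<^sub>v a0"
    unfolding z_def by (rule mult_add_distrib_mat_vec[OF Vf xc a0c])
  have Vfc: "Vf *\<^sub>v x \<in> carrier_vec n" "Vf *\<^sub>v a0 \<in> carrier_vec n" using Vf xc a0c by auto
  define t where "t = x - Vf *\<^sub>v x"
  have tc: "t \<in> carrier_vec n" using xc Vfc by (simp add: t_def)
  define E where "E = (a0 - Vf *\<^sub>v a0) + e1 - D w' - P *\<^sub>v ec - e4"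
  have Ec: "E \<in> carrier_vec n" using a0c Vfc e1 Dc[OF w'c] Pec e4p by (simp add: E_def)
  have key: "yh - d = t + E"
  proof (rule eq_vecI)
    fix i assume "i < dim_vec (t + E)"
    then have i: "i < n" using Ec by simp
    have "Gz $ i - D g $ i = (Vf *\<^sub>v x) $ i + (Vf *\<^sub>v a0) $ i"
      using arg_cong[OF trans[OF Vz[symmetric] Vz'], of "\<lambda>v. v $ i"] i Gzc Dc[OF gc] Vfc Vf
      by (simp del: index_mult_mat_vec)
    then show "(yh - d) $ i = (t + E) $ i"
      unfolding yh_eq d Pdc Dw t_def E_def z_def
      using i xc a0c Gzc Dc[OF w'c] Dc[OF gc] Pec e4p Vfc e1 Vf P by (simp del: index_mult_mat_vec)
  qed (use Ec e4p in \<open>simp add: d\<close>)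

  \<comment> \<open>Twice the sum of \<tau> and the bound \<open>w'n\<close>, with 2 bounding 1 +
    \<rho> + \<open>\<delta>c\<close>, then \<sigma> \<tau> for \<open>e1\<close> and the last
    summand for \<open>e4\<close>.\<close>
  define S where "S = 2 * \<tau> + 3 * \<sigma> * \<tau> + 4 * K * \<tau> + 2 * \<mu> * X + 2 / 3 * \<mu> * (X + \<mu> * X)"
  have En: "?en E \<le> \<delta>c * N + S * N"
  proof -
    have "?en E \<le> ?en (a0 - Vf *\<^sub>v a0) + ?en e1 + ?en (D w') + ?en (P *\<^sub>v ec) + ?en e4"
      unfolding E_def using a0c Vfc e1 Dc[OF w'c] Pec e4p
      by (intro order_trans[OF trim] add_mono order_trans[OF tri] order_refl) auto
    also have "\<dots> \<le> (1 + \<rho>) * ?en a0 + ?en e1 + (1 + \<rho>) * ?ec w' + \<delta>c * (?ec w' + (N + \<tau> * N)) + ?en e4"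
    proof -
      have "?en (a0 - Vf *\<^sub>v a0) \<le> (1 + \<rho>) * ?en a0"
        using trim[OF a0c Vfc(2)] Vf_le[OF a0c] by (simp add: algebra_simps)
      moreover have "?en (P *\<^sub>v ec) \<le> \<delta>c * (?ec w' + (N + \<tau> * N))"
        using Pecn mult_left_mono[OF wn \<delta>c] by simp
      ultimately show ?thesis using Dn[OF w'c] by simp
    qed
    also have "\<dots> \<le> (1 + \<rho>) * (\<tau> * N) + ?en e1 + (1 + \<rho>) * ?ec w' + \<delta>c * (?ec w' + (N + \<tau> * N)) + ?en e4"
      using a0n \<rho> by (intro add_mono mult_left_mono order_refl) auto
    also have "\<dots> = \<delta>c * N + (1 + (\<rho> + \<delta>c)) * (\<tau> * N + ?ec w') + ?en e1 + ?en e4"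
      by (simp add: algebra_simps)
    also have "\<dots> \<le> \<delta>c * N + 2 * (\<tau> * N + ?ec w') + ?en e1 + ?en e4"
      using \<rho>\<delta> \<tau>0 N0 by (intro add_mono mult_right_mono order_refl) auto
    also have "\<dots> \<le> \<delta>c * N + S * N"
    proof -
      define W Y where "W = \<sigma> * \<tau> * N + 2 * K * \<tau> * N + \<mu> * (X * N)"
        and "Y = 2 / 3 * \<mu> * (X + \<mu> * X) * N"
      have SN: "\<delta>c * N + S * N = \<delta>c * N + 2 * (\<tau> * N + W) + \<sigma> * \<tau> * N + Y"
        by (simp add: S_def W_def Y_def field_simps)
      show ?thesis unfolding SN using w'n[folded W_def] e1n e4n[folded Y_def]
        by (intro add_mono mult_left_mono order_refl) auto
    qed
    finally show ?thesis .
  qed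
  have tn: "?en t \<le> (1 + \<rho>) * N"
    using trim[OF xc Vfc(1)] Vf_le[OF xc] by (simp add: t_def N_def algebra_simps)
  have tE: "?en (t + E) \<le> (1 + \<rho>) * N + (\<delta>c * N + S * N)"
    using tri[OF tc Ec] tn En by simp
  have tE': "?en (t + E) \<le> (2 + S) * N"
    using tE mult_right_mono[OF \<rho>\<delta> N0] by (simp add: algebra_simps)

  \<comment> \<open>The rounding error of the update. It is componentwise relative to
    \<open>t + E\<close>, so passing to the Euclidean norm and back turns \<epsilon> into
    \<tau>.\<close>
  define f where "f = y - (t + E)"
  have yc: "y \<in> carrier_vec n" by (simp add: y)
  have fc: "f \<in> carrier_vec n" using yc tc Ec by (simp add: f_def)
  have fn: "?en f \<le> \<tau> * ((2 + S) * N)"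
  proof -
    have dh: "dim_vec d = n" "dim_vec yh = n" using e4p e1 by (simp_all add: d yh)
    have "vnorm f \<le> \<epsilon> * vnorm (t + E)"
    proof (rule vnorm_le_cmult)
      fix i assume "i < dim_vec (t + E)"
      then have i: "i < n" using tc Ec by simp
      have tEi: "(t + E) $ i = yh $ i - d $ i" unfolding key[symmetric] using i dh by simp
      have "f $ i = y $ i - (t + E) $ i" unfolding f_def using i tc Ec by simp
      then have "f $ i = (t + E) $ i * e5 $ i" unfolding tEi using i by (simp add: y algebra_simps)
      then show "\<bar>f $ i\<bar> \<le> \<epsilon> * \<bar>(t + E) $ i\<bar>"
        using e5 i mult_right_mono[of "\<bar>e5 $ i\<bar>" \<epsilon> "\<bar>(t + E) $ i\<bar>"] by (simp add: abs_mult mult.commute)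
    qed (use fc tc Ec \<epsilon> in auto)
    also have "\<dots> \<le> \<epsilon> * (sqrt ?ai * ?en (t + E))"
      using vnorm_le_energy_norm[OF A spd, of "t + E"] tc Ec \<epsilon> by (intro mult_left_mono) auto
    finally have 1: "vnorm f \<le> \<epsilon> * (sqrt ?ai * ?en (t + E))" .
    have "?en f \<le> sqrt ?a * vnorm f" by (rule energy_norm_le_vnorm[OF A spd fc])
    also have "\<dots> \<le> sqrt ?a * (\<epsilon> * (sqrt ?ai * ?en (t + E)))"
      using 1 qq0 by (intro mult_left_mono) auto
    also have "\<dots> = \<tau> * ?en (t + E)" by (simp add: \<tau> cond_num_def real_sqrt_mult mult_ac)
    also have "\<dots> \<le> \<tau> * ((2 + S) * N)" using tE' \<tau>0 by (intro mult_left_mono)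
    finally show ?thesis .
  qed
  have "y - t = f + E" unfolding f_def using yc tc Ec by (intro eq_vecI) auto
  then have "?en (y - t) \<le> \<tau> * ((2 + S) * N) + (\<delta>c * N + S * N)"
    using tri[OF fc Ec] fn En by simp
  also have "\<dots> = (\<delta>c + (S + \<tau> * (2 + S))) * N" by (simp add: algebra_simps)
  also have "\<dots> \<le> (\<delta>c + (4 * \<tau> + (2 + beta \<sigma> mAp) * \<mu> + 2 * \<tau>\<^sup>2 + (4 + beta \<sigma> mAp) * \<mu> * \<tau> + 2 * \<mu> * \<tau>\<^sup>2)) * N"
  proof (intro mult_right_mono add_left_mono N0 step_budget[OF \<tau>0 \<sigma>0 K0 \<tau>\<mu> _ X_def S_def \<beta>])
    show "\<mu> * (4 + 3 * \<sigma> + 2 * K) \<le> 1" using small by (simp add: \<beta> add.assoc)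
  qed
  finally show ?thesis by (simp add: t_def x_def N_def)
qed

section \<open>The whole cycle\<close>

text \<open>Both terms with \<open>P\<close> act through the same coarse solution \<open>w\<close>;
  combining them exhibits the correction actually computed by an exact coarse cycle.\<close>

lemma two_level_err_mult_vec:
  fixes A P V C G :: "real mat"
  assumes A: "A \<in> carrier_mat n n" and P: "P \<in> carrier_mat n k" and V: "V \<in> carrier_mat k k"
    and C: "C \<in> carrier_mat k k" and G: "G \<in> carrier_mat n n" and v: "v \<in> carrier_vec n"
    and w: "w = C *\<^sub>v (transpose_mat P *\<^sub>v (A *\<^sub>v (G *\<^sub>v v)))"
  shows "((P * V * C * transpose_mat P * A + (1\<^sub>m n - P * C * transpose_mat P * A)) * G) *\<^sub>v v
    = G *\<^sub>v v - P *\<^sub>v (w - V *\<^sub>v w)"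
proof -
  define u where "u = G *\<^sub>v v"
  have u: "u \<in> carrier_vec n" using G v by (simp add: u_def)
  have Pt: "transpose_mat P \<in> carrier_mat k n" using P by simp
  have Au: "A *\<^sub>v u \<in> carrier_vec n" and PAu: "transpose_mat P *\<^sub>v (A *\<^sub>v u) \<in> carrier_vec k"
    using A Pt u by auto
  have wc: "w \<in> carrier_vec k" using C PAu by (simp add: w u_def)
  have Vw: "V *\<^sub>v w \<in> carrier_vec k" using V wc by simp
  let ?B1 = "P * V * C * transpose_mat P * A" and ?B2 = "P * C * transpose_mat P * A"
  have B1: "?B1 \<in> carrier_mat n n" and B2: "?B2 \<in> carrier_mat n n" using A P V C by auto
  have PVC: "P * V * C \<in> carrier_mat n k" and PC: "P * C \<in> carrier_mat n k" and PV: "P * V \<in> carrier_mat n k"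
    using P V C by auto
  have "?B1 *\<^sub>v u = P *\<^sub>v (V *\<^sub>v w)"
    by (simp only: assoc_mult_mat_vec[OF mult_carrier_mat[OF PVC Pt] A u] assoc_mult_mat_vec[OF PVC Pt Au]
        assoc_mult_mat_vec[OF PV C PAu] assoc_mult_mat_vec[OF P V wc] w[folded u_def, symmetric])
  moreover have "?B2 *\<^sub>v u = P *\<^sub>v w"
    by (simp only: assoc_mult_mat_vec[OF mult_carrier_mat[OF PC Pt] A u] assoc_mult_mat_vec[OF PC Pt Au]
        assoc_mult_mat_vec[OF P C PAu] w[folded u_def, symmetric])
  moreover have "((?B1 + (1\<^sub>m n - ?B2)) * G) *\<^sub>v v = ?B1 *\<^sub>v u + (1\<^sub>m n - ?B2) *\<^sub>v u"
    using assoc_mult_mat_vec[OF add_carrier_mat[OF minus_carrier_mat[OF B2], of ?B1 "1\<^sub>m n"] G v]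
      add_mult_distrib_mat_vec[OF B1 minus_carrier_mat[OF B2] u] by (simp only: u_def)
  moreover have "(1\<^sub>m n - ?B2) *\<^sub>v u = u - ?B2 *\<^sub>v u"
    using minus_mult_distrib_mat_vec[OF one_carrier_mat B2 u] u by simp
  ultimately have "((?B1 + (1\<^sub>m n - ?B2)) * G) *\<^sub>v v = P *\<^sub>v (V *\<^sub>v w) + (u - P *\<^sub>v w)"
    by simp
  also have "\<dots> = u - (P *\<^sub>v w - P *\<^sub>v (V *\<^sub>v w))"
    using u P wc Vw by (intro eq_vecI) auto
  also have "P *\<^sub>v w - P *\<^sub>v (V *\<^sub>v w) = P *\<^sub>v (w - V *\<^sub>v w)"
    by (rule mult_minus_distrib_mat_vec[OF P wc Vw, symmetric])
  finally show ?thesis by (simp only: u_def)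
qed

lemma vcycle_err_carrier:
  assumes A: "\<And>j. j \<in> {1..l} \<Longrightarrow> A j \<in> carrier_mat (n j) (n j)"
    and P: "\<And>j. j \<in> {2..l} \<Longrightarrow> P j \<in> carrier_mat (n j) (n (j - 1))"
    and M: "\<And>j. j \<in> {1..l} \<Longrightarrow> M j \<in> carrier_mat (n j) (n j)"
    and j: "j \<in> {1..l}"
  shows "vcycle_err A P M j \<in> carrier_mat (n j) (n j)"
proof -
  have G: "relax_err A M j \<in> carrier_mat (n j) (n j)"
    using A[OF j] minus_carrier_mat[OF mult_carrier_mat[OF M[OF j] A[OF j]]] by (simp add: relax_err_def)
  show ?thesis
  proof (cases "j = 1")
    case True
    then show ?thesis using G by simp
  next
    case False
    then obtain i where i: "j = Suc (Suc i)" using j by (metis One_nat_def atLeastAtMost_iff not0_implies_Suc not_one_le_zero)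
    have "P j \<in> carrier_mat (n j) (n (j - 1))" using P[of j] j i by simp
    then have "coarse_corr_err A P j \<in> carrier_mat (n j) (n j)"
      using A[OF j] by (intro carrier_matI) (simp_all add: coarse_corr_err_def)
    then show ?thesis
      using G unfolding i vcycle_err.simps(2) Let_def by (intro mult_carrier_mat add_carrier_mat)
  qed
qed

lemma vcycle_err_mult_vec:
  assumes A: "A j \<in> carrier_mat (n j) (n j)" and P: "P j \<in> carrier_mat (n j) (n (j - 1))"
    and M: "M j \<in> carrier_mat (n j) (n j)"
    and V: "vcycle_err A P M (j - 1) \<in> carrier_mat (n (j - 1)) (n (j - 1))"
    and C: "inv_mat (A (j - 1)) \<in> carrier_mat (n (j - 1)) (n (j - 1))"
    and j: "2 \<le> j" and v: "v \<in> carrier_vec (n j)"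
    and w: "w = inv_mat (A (j - 1)) *\<^sub>v (transpose_mat (P j) *\<^sub>v (A j *\<^sub>v (relax_err A M j *\<^sub>v v)))"
  shows "vcycle_err A P M j *\<^sub>v v = relax_err A M j *\<^sub>v v - P j *\<^sub>v (w - vcycle_err A P M (j - 1) *\<^sub>v w)"
proof -
  obtain i where i: "j = Suc (Suc i)" using j by (metis Suc_le_D numeral_2_eq_2 Suc_le_mono)
  have G: "relax_err A M j \<in> carrier_mat (n j) (n j)"
    using A minus_carrier_mat[OF mult_carrier_mat[OF M A]] by (simp add: relax_err_def)
  have d: "dim_row (A j) = n j" using A by simp
  show ?thesis
    using two_level_err_mult_vec[OF A P V C G v w] i
    unfolding i vcycle_err.simps(2) Let_def coarse_corr_err_def d[unfolded i] by simp
qed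

lemma rounded_cycle_carrier:
  assumes "rounded_cycle A P M eps \<alpha> mAp mPp j r y"
  shows "y \<in> carrier_vec (dim_row (A j))"
  using assms by cases (auto intro!: carrier_vecI)

text \<open>The m-th power of \<open>mesh_size\<close> is the inverse square root of the condition
  number, so the m-th power of the quantity minimised in \<open>vartheta\<close> is exactly the
  quotient of the two values of \<open>tau\<close>.\<close>

lemma tau_coarse_le:
  assumes m: "0 < m" and j: "j \<in> {2..l}" and \<kappa>: "0 < cond_num (A j)" "0 < cond_num (A (j - 1))"
    and eps: "0 < eps j" "0 < eps (j - 1)" and v: "0 \<le> vartheta l m A eps"
  shows "vartheta l m A eps ^ m * tau A eps (j - 1) \<le> tau A eps j"
proof -
  have pw: "(x powr (- 1 / (2 * real m))) ^ m = 1 / sqrt x" if "0 < x" for x :: real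
    using that m by (simp add: powr_power powr_minus powr_half_sqrt field_simps)
  have "vartheta l m A eps \<le> theta_lev m A j * zeta_lev eps j powr (- 1 / real m)"
    unfolding vartheta_def using j by (intro Min_le) auto
  then have "vartheta l m A eps ^ m \<le> (theta_lev m A j * zeta_lev eps j powr (- 1 / real m)) ^ m"
    using v by (rule power_mono)
  also have "\<dots> = sqrt (cond_num (A j)) / sqrt (cond_num (A (j - 1))) / zeta_lev eps j"
  proof -
    have "theta_lev m A j ^ m = sqrt (cond_num (A j)) / sqrt (cond_num (A (j - 1)))"
      unfolding theta_lev_def mesh_size_def power_divide pw[OF \<kappa>(1)] pw[OF \<kappa>(2)] by simp
    moreover have "(zeta_lev eps j powr (- 1 / real m)) ^ m = 1 / zeta_lev eps j"
      using m eps by (simp add: powr_power powr_minus zeta_lev_def field_simps)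
    ultimately show ?thesis by (simp add: power_mult_distrib)
  qed
  also have "\<dots> = tau A eps j / tau A eps (j - 1)" by (simp add: tau_def zeta_lev_def)
  finally show ?thesis
    using \<kappa> eps by (simp add: tau_def pos_le_divide_eq)
qed

text \<open>The function is a cubic with nonnegative coefficients and no constant term. In each
  power of t' one factor supplies \<open>c\<close>, the others are bounded by
  \<open>t\<close>.\<close>

lemma delta_rho_tg_scale:
  assumes t: "0 \<le> t'" "t' \<le> c * t" and c: "c \<le> 1" and t0: "0 \<le> t"
    and k: "0 \<le> zeta_max l eps" "0 \<le> cond_PtP l P" "0 \<le> mP_plus l mP eps" and b: "0 \<le> beta \<sigma> (mA_plus l mA eps)"
  shows "delta_rho_tg l P mA mP eps \<sigma> t' \<le> c * delta_rho_tg l P mA mP eps \<sigma> t"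
proof -
  define k where "k = 3 * zeta_max l eps * sqrt (cond_PtP l P) * mP_plus l mP eps"
  have k0: "0 \<le> k" using assms by (simp add: k_def)
  have ct: "t' \<le> t" using t c t0 mult_right_mono[OF c t0] by linarith
  have t2: "t'\<^sup>2 \<le> c * t\<^sup>2"
    using mult_mono[OF t(2) ct _ t(1)] t by (simp add: power2_eq_square mult.assoc)
  have t3: "t' ^ 3 \<le> c * t ^ 3"
    using mult_mono[OF t2 ct order_trans[OF zero_le_power2 t2] t(1)] by (simp add: power2_eq_square power3_eq_cube mult.assoc)
  let ?b = "beta \<sigma> (mA_plus l mA eps)"
  have *: "delta_rho_tg l P mA mP eps \<sigma> t = (4 + (2 + ?b) * k) * t + (2 + (4 + ?b) * k) * t\<^sup>2 + 2 * k * t ^ 3" for t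
    by (simp add: delta_rho_tg_def mu_def k_def Let_def algebra_simps power2_eq_square power3_eq_cube)
  have "(4 + (2 + ?b) * k) * t' + (2 + (4 + ?b) * k) * t'\<^sup>2 + 2 * k * t' ^ 3
    \<le> (4 + (2 + ?b) * k) * (c * t) + (2 + (4 + ?b) * k) * (c * t\<^sup>2) + 2 * k * (c * t ^ 3)"
    using t2 t3 t k0 b by (intro add_mono mult_left_mono) auto
  then show ?thesis unfolding * by (simp add: algebra_simps)
qed

theorem theorem8p1:
  fixes l m :: nat
    and n mA mP :: "nat \<Rightarrow> nat"
    and A P M :: "nat \<Rightarrow> real mat"
    and eps \<alpha> :: "nat \<Rightarrow> real"
    and \<rho>_star \<sigma> :: real
    and r y :: "real vec"
  assumes levels: "2 \<le> l"
    and dims: "\<And>j. j \<in> {1..l} \<Longrightarrow> 0 < n j"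
    and A_carrier: "\<And>j. j \<in> {1..l} \<Longrightarrow> A j \<in> carrier_mat (n j) (n j)"
    and A_spd: "\<And>j. j \<in> {1..l} \<Longrightarrow> spd_mat (A j)"
    and A_sparse: "\<And>j. j \<in> {1..l} \<Longrightarrow> row_nonzeros_le (A j) (mA j)"
    and P_carrier: "\<And>j. j \<in> {2..l} \<Longrightarrow> P j \<in> carrier_mat (n j) (n (j - 1))"
    and P_rank: "\<And>j. j \<in> {2..l} \<Longrightarrow> vec_space.rank (n j) (P j) = n (j - 1)"
    and P_sparse_rows: "\<And>j. j \<in> {2..l} \<Longrightarrow> row_nonzeros_le (P j) (mP j)"
    and P_sparse_cols: "\<And>j. j \<in> {2..l} \<Longrightarrow> col_nonzeros_le (P j) (mP j)"
    and P_pos: "\<And>j i k. j \<in> {2..l} \<Longrightarrow> i < n j \<Longrightarrow> k < n (j - 1) \<Longrightarrow>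
                  P j $$ (i, k) \<noteq> 0 \<Longrightarrow> P j $$ (i, k) > 0"
    and galerkin: "\<And>j. j \<in> {2..l} \<Longrightarrow> A (j - 1) = transpose_mat (P j) * A j * P j"
    and M_carrier: "\<And>j. j \<in> {1..l} \<Longrightarrow> M j \<in> carrier_mat (n j) (n j)"
    and M_nonsingular: "\<And>j. j \<in> {1..l} \<Longrightarrow> invertible_mat (M j)"
    and relax_conv: "\<And>j. j \<in> {1..l} \<Longrightarrow> energy_mat_norm (A j) (relax_err A M j) < 1"
    and rho_range: "0 \<le> \<rho>_star" "\<rho>_star < 1"
    and V_bound: "\<And>j. j \<in> {1..l} \<Longrightarrow> energy_mat_norm (A j) (vcycle_err A P M j) \<le> \<rho>_star"
    and eps_range: "\<And>j. j \<in> {1..l} \<Longrightarrow> 0 < eps j \<and> eps j < 1"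
    and zeta_ge_1: "\<And>j. j \<in> {2..l} \<Longrightarrow> zeta_lev eps j \<ge> 1"
    and m_pos: "0 < m"
    and vartheta_gt_1: "vartheta l m A eps > 1"
    and denom_P: "\<And>j. j \<in> {2..l} \<Longrightarrow> 1 - real (mP j) * eps j > 0"
    and denom_A: "\<And>j. j \<in> {1..l} \<Longrightarrow> 1 - (real (mA j) + 1) * eps j > 0"
    and sigma: "\<And>j. j \<in> {1..l} \<Longrightarrow>
          \<sigma> \<ge> (1 + eps j) * Max {\<alpha> j * mat_norm (A j), \<alpha> j * mat_norm (abs_mat (A j)),
                                  mat_norm (abs_mat (A j)) * mat_norm (M j)}"
    and tau_small: "\<And>j. j \<in> {1..l} \<Longrightarrow>
          delta_rho_v l m A P mA mP eps \<sigma> (tau A eps j) < 1 - \<rho>_star"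
    and r_carrier: "r \<in> carrier_vec (n l)"
    and cycle: "rounded_cycle A P M eps \<alpha> (mA_plus l mA eps) (mP_plus l mP eps) l r y"
  shows "energy_norm (A l) (y - inv_mat (A l) *\<^sub>v r)
           \<le> (\<rho>_star + delta_rho_v l m A P mA mP eps \<sigma> (tau A eps l))
              * energy_norm (A l) (inv_mat (A l) *\<^sub>v r)"
proof -
  define mAp mPp \<zeta> \<kappa>P b F where "mAp = mA_plus l mA eps" and "mPp = mP_plus l mP eps"
    and "\<zeta> = zeta_max l eps" and "\<kappa>P = cond_PtP l P" and "b = beta \<sigma> mAp" and "F = vartheta l m A eps ^ m"
  define \<delta>t \<delta>v where "\<delta>t = delta_rho_tg l P mA mP eps \<sigma>" and "\<delta>v = delta_rho_v l m A P mA mP eps \<sigma>"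
  define V where "V = vcycle_err A P M"
  have coarse: "j - 1 \<in> {1..l}" "j \<in> {1..l}" if "j \<in> {2..l}" for j using that by auto
  have spdC: "spd_mat (transpose_mat (P j) * A j * P j)" if "j \<in> {2..l}" for j
    using galerkin[OF that] A_spd[OF coarse(1)[OF that]] by simp
  have \<kappa>1: "1 \<le> cond_num (A j)" if "j \<in> {1..l}" for j
    using that by (intro cond_num_spd_ge_1[OF A_carrier A_spd dims])
  have \<kappa>P1: "1 \<le> cond_num (transpose_mat (P j) * P j)" "cond_num (transpose_mat (P j) * P j) \<le> \<kappa>P"
    if j: "j \<in> {2..l}" for j
  proof -
    note c = A_carrier[OF coarse(2)[OF j]] A_spd[OF coarse(2)[OF j]] P_carrier[OF j] dims[OF coarse(2)[OF j]]
      dims[OF coarse(1)[OF j]] spdC[OF j]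
    show "1 \<le> cond_num (transpose_mat (P j) * P j)"
      by (rule cond_num_spd_ge_1[OF gram_carrier[OF c] spd_gram[OF c] dims[OF coarse(1)[OF j]]])
    show "cond_num (transpose_mat (P j) * P j) \<le> \<kappa>P"
      unfolding \<kappa>P_def cond_PtP_def using j by (intro Max_ge) auto
  qed
  have \<zeta>j: "eps (j - 1) \<le> \<zeta> * eps j" if j: "j \<in> {2..l}" for j
  proof -
    have "zeta_lev eps j \<le> \<zeta>" unfolding \<zeta>_def zeta_max_def using j by (intro Max_ge) auto
    then show ?thesis using eps_range[OF coarse(2)[OF j]] by (simp add: zeta_lev_def pos_divide_le_eq)
  qed
  have l2: "2 \<in> {2..l}" and l1: "1 \<in> {1..l}" using levels by auto
  have "zeta_lev eps 2 \<le> \<zeta>" unfolding \<zeta>_def zeta_max_def using l2 by (intro Max_ge) auto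
  then have \<zeta>1: "1 \<le> \<zeta>" using zeta_ge_1[OF l2] by simp
  have \<kappa>P1': "1 \<le> \<kappa>P" using \<kappa>P1[OF l2] by simp
  \<comment> \<open>An injective matrix on a nonzero space has a nonzero entry, hence
    \<open>mP 2\<close> is at least 1. This lets the roundoff term without the factor
    \<open>mPp\<close> in the restriction error be absorbed into \<mu>.\<close>
  have mPp1: "1 \<le> mPp"
  proof -
    note c = A_carrier[OF coarse(2)[OF l2]] A_spd[OF coarse(2)[OF l2]] P_carrier[OF l2] dims[OF coarse(2)[OF l2]]
      dims[OF coarse(1)[OF l2]] spdC[OF l2]
    obtain i k where ik: "i < n 2" "k < n 1" "P 2 $$ (i, k) \<noteq> 0"
    proof (rule ccontr)
      assume "\<not> thesis"
      then have "\<And>i k. i < n 2 \<Longrightarrow> k < n 1 \<Longrightarrow> P 2 $$ (i, k) = 0" using that by blast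
      then have "P 2 = 0\<^sub>m (n 2) (n 1)" using P_carrier[OF l2] by (intro eq_matI) auto
      then have "P 2 *\<^sub>v unit_vec (n 1) 0 = 0\<^sub>v (n 2)" by auto
      then have "unit_vec (n 1) 0 = (0\<^sub>v (n 1) :: real vec)" using interpolation_ker[OF c] by simp
      then have "(unit_vec (n 1) 0 :: real vec) $ 0 = 0\<^sub>v (n 1) $ 0" by simp
      then show False using dims[OF l1] by simp
    qed
    have "k \<in> {c. c < dim_col (P 2) \<and> P 2 $$ (i, c) \<noteq> 0}" using ik P_carrier[OF l2] by simp
    then have "0 < card {c. c < dim_col (P 2) \<and> P 2 $$ (i, c) \<noteq> 0}" by (subst card_gt_0_iff) auto
    then have "1 \<le> mP 2" 
      using P_sparse_rows[OF l2, unfolded row_nonzeros_le_def, rule_format, of i] ik(1) carrier_matD(1)[OF P_carrier[OF l2]]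
      by linarith
    moreover have "0 \<le> real (mP 2) * eps 2" using eps_range[OF coarse(2)[OF l2]] by simp
    ultimately have "1 - real (mP 2) * eps 2 \<le> real (mP 2)" by linarith
    then have "1 \<le> real (mP 2) / (1 - real (mP 2) * eps 2)"
      using denom_P[OF l2] by (simp add: pos_le_divide_eq)
    also have "\<dots> \<le> mPp" unfolding mPp_def mP_plus_def using l2 by (intro Max_ge) auto
    finally show ?thesis .
  qed
  have mAp0: "0 \<le> mAp"
  proof -
    have "0 \<le> (real (mA 1) + 1) / (1 - (real (mA 1) + 1) * eps 1)" using denom_A[OF l1] by simp
    also have "\<dots> \<le> mAp" unfolding mAp_def mA_plus_def using l1 by (intro Max_ge) auto
    finally show ?thesis .
  qed
  have sig: "(1 + eps j) * (\<alpha> j * mat_norm (A j)) \<le> \<sigma>" "(1 + eps j) * (\<alpha> j * mat_norm (abs_mat (A j))) \<le> \<sigma>"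
    "(1 + eps j) * (mat_norm (abs_mat (A j)) * mat_norm (M j)) \<le> \<sigma>" if j: "j \<in> {1..l}" for j
    using eps_range[OF j] by (auto intro!: order_trans[OF mult_left_mono sigma[OF j]] Max_ge)
  have \<sigma>0: "0 \<le> \<sigma>"
  proof -
    have "abs_mat (A 1) \<in> carrier_mat (n 1) (n 1)" using A_carrier[OF l1] by (simp add: abs_mat_def)
    then show ?thesis
      using eps_range[OF l1] mat_norm_nonneg dims[OF l1] M_carrier[OF l1]
      by (intro order_trans[OF _ sig(3)[OF l1]] mult_nonneg_nonneg) auto
  qed
  have b2: "2 + 3 * \<sigma> \<le> b" using mAp0 \<sigma>0 by (simp add: b_def beta_def)
  have b0: "0 \<le> b" using b2 \<sigma>0 by simp
  define k where "k = \<zeta> * sqrt \<kappa>P * mPp"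
  have k1: "1 \<le> k"
    using mult_mono[OF mult_mono[OF \<zeta>1, of 1 "sqrt \<kappa>P"] mPp1] \<zeta>1 \<kappa>P1' mPp1 by (simp add: k_def)
  have mu: "mu \<zeta> \<kappa>P mPp t = 3 * k * t" for t by (simp add: mu_def k_def)
  have \<delta>t_eq: "\<delta>t t = 4 * t + (2 + b) * (3 * k * t) + 2 * t\<^sup>2 + (4 + b) * (3 * k * t) * t + 2 * (3 * k * t) * t\<^sup>2" for t
    unfolding \<delta>t_def delta_rho_tg_def Let_def \<zeta>_def[symmetric] \<kappa>P_def[symmetric] mPp_def[symmetric]
      mAp_def[symmetric] b_def[symmetric] mu ..
  \<comment> \<open>Keeping a single summand turns the smallness assumption into the bound \<mu> (2
    + \<beta>) \<le> 1 required by \<open>two_level_error\<close>.\<close>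
  have \<delta>t_ge: "(2 + b) * (3 * k * t) \<le> \<delta>t t" "0 \<le> \<delta>t t" if "0 \<le> t" for t
    using that k1 b0 by (auto simp: \<delta>t_eq)
  have F1: "1 < F" using vartheta_gt_1 m_pos by (simp add: F_def one_less_power)
  have \<delta>v_eq: "\<delta>v t = F / (F - 1) * \<delta>t t" for t by (simp add: \<delta>v_def \<delta>t_def delta_rho_v_def F_def)
  have \<delta>tv: "\<delta>t t \<le> \<delta>v t" if "0 \<le> t" for t
  proof -
    have "1 * \<delta>t t \<le> F / (F - 1) * \<delta>t t" using F1 \<delta>t_ge(2)[OF that] by (intro mult_right_mono) auto
    then show ?thesis by (simp add: \<delta>v_eq)
  qed
  have \<tau>0: "0 < tau A eps j" if "j \<in> {1..l}" for j
    using \<kappa>1[OF that] eps_range[OF that] by (simp add: tau_def)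
  have \<delta>v_step: "\<delta>v (tau A eps (j - 1)) + \<delta>t (tau A eps j) \<le> \<delta>v (tau A eps j)" if j: "j \<in> {2..l}" for j
  proof -
    have "F * tau A eps (j - 1) \<le> tau A eps j"
      unfolding F_def using m_pos vartheta_gt_1 \<kappa>1[OF coarse(1)[OF j]] \<kappa>1[OF coarse(2)[OF j]]
        eps_range[OF coarse(1)[OF j]] eps_range[OF coarse(2)[OF j]]
      by (intro tau_coarse_le[OF m_pos j]) auto
    then have "tau A eps (j - 1) \<le> 1 / F * tau A eps j" using F1 by (simp add: field_simps)
    then have "\<delta>t (tau A eps (j - 1)) \<le> 1 / F * \<delta>t (tau A eps j)"
      unfolding \<delta>t_def using F1 \<tau>0[OF coarse(1)[OF j]] \<tau>0[OF coarse(2)[OF j]] \<zeta>1 \<kappa>P1' mPp1 b0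
      by (intro delta_rho_tg_scale) (auto simp: \<zeta>_def \<kappa>P_def mPp_def b_def mAp_def)
    \<comment> \<open>The inherited part becomes 1 / (F - 1) times the local term; the new local
      term adds 1, and the sum is F / (F - 1) again.\<close>
    then have "\<delta>v (tau A eps (j - 1)) \<le> F / (F - 1) * (1 / F * \<delta>t (tau A eps j))"
      unfolding \<delta>v_eq using F1 by (intro mult_left_mono) auto
    also have "\<dots> = 1 / (F - 1) * \<delta>t (tau A eps j)" using F1 by simp
    finally have "\<delta>v (tau A eps (j - 1)) + \<delta>t (tau A eps j) \<le> (1 + 1 / (F - 1)) * \<delta>t (tau A eps j)"
      by (simp add: algebra_simps)
    also have "1 + 1 / (F - 1) = F / (F - 1)" using F1 by (simp add: field_simps)
    finally show ?thesis by (simp only: \<delta>v_eq)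
  qed
  have small: "\<rho>_star + \<delta>v (tau A eps j) \<le> 1" if "j \<in> {1..l}" for j
    using tau_small[OF that] by (simp add: \<delta>v_def)
  have Vc: "V j \<in> carrier_mat (n j) (n j)" if "j \<in> {1..l}" for j
    unfolding V_def by (rule vcycle_err_carrier[where n = n and l = l, OF A_carrier P_carrier M_carrier that])
  have V_le: "energy_norm (A j) (V j *\<^sub>v v) \<le> \<rho>_star * energy_norm (A j) v"
    if j: "j \<in> {1..l}" and v: "v \<in> carrier_vec (n j)" for j v
  proof -
    have "energy_norm (A j) (V j *\<^sub>v v) \<le> energy_mat_norm (A j) (V j) * energy_norm (A j) v"
      by (rule energy_norm_mult_le_energy_mat_norm[OF A_carrier[OF j] A_spd[OF j] Vc[OF j] v])
    also have "\<dots> \<le> \<rho>_star * energy_norm (A j) v"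
      using V_bound[OF j] by (intro mult_right_mono) (auto simp: V_def)
    finally show ?thesis .
  qed
  have G_eq: "relax_err A M j = 1\<^sub>m (n j) - M j * A j" if "j \<in> {1..l}" for j
    using A_carrier[OF that] by (simp add: relax_err_def)
  have G_le: "energy_norm (A j) (relax_err A M j *\<^sub>v v) \<le> energy_norm (A j) v"
    if j: "j \<in> {1..l}" and v: "v \<in> carrier_vec (n j)" for j v
  proof -
    have "relax_err A M j \<in> carrier_mat (n j) (n j)"
      unfolding G_eq[OF j] by (rule minus_carrier_mat[OF mult_carrier_mat[OF M_carrier[OF j] A_carrier[OF j]]])
    then have "energy_norm (A j) (relax_err A M j *\<^sub>v v) \<le> energy_mat_norm (A j) (relax_err A M j) * energy_norm (A j) v"
      by (rule energy_norm_mult_le_energy_mat_norm[OF A_carrier[OF j] A_spd[OF j] _ v])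
    also have "\<dots> \<le> 1 * energy_norm (A j) v"
      using relax_conv[OF j] by (intro mult_right_mono) auto
    finally show ?thesis by simp
  qed

  have main: "energy_norm (A j) (y - (inv_mat (A j) *\<^sub>v r - V j *\<^sub>v (inv_mat (A j) *\<^sub>v r)))
      \<le> \<delta>v (tau A eps j) * energy_norm (A j) (inv_mat (A j) *\<^sub>v r)"
    if "rounded_cycle A P M eps \<alpha> mAp mPp j r y" "j \<le> l" for j r y
    using that
  proof (induction rule: rounded_cycle.induct)
    case (coarsest r e0 r0 e1 y)
    have d1: "dim_row (A 1) = n 1" using A_carrier[OF l1] by simp
    have "energy_norm (A 1) (M 1 *\<^sub>v (r + e0) + e1
          - (inv_mat (A 1) *\<^sub>v r - relax_err A M 1 *\<^sub>v (inv_mat (A 1) *\<^sub>v r)))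
        \<le> (2 + \<sigma>) * (sqrt (cond_num (A 1)) * eps 1) * energy_norm (A 1) (inv_mat (A 1) *\<^sub>v r)"
      using coarsest(1,2,3,5,6) eps_range[OF l1] unfolding d1 coarsest(4)
      by (intro coarsest_level_error[OF A_carrier[OF l1] A_spd[OF l1] dims[OF l1] M_carrier[OF l1] _ _ sig[OF l1]
            _ _ _ _ _ G_eq[OF l1] G_le[OF l1]]) auto
    also have "\<dots> \<le> \<delta>v (tau A eps 1) * energy_norm (A 1) (inv_mat (A 1) *\<^sub>v r)"
    proof (intro mult_right_mono)
      \<comment> \<open>The coarsest level needs only the summand (2 + \<beta>) \<mu>, since \<beta>
        dominates \<sigma> and \<mu> dominates \<tau>.\<close>
      have "(2 + \<sigma>) * tau A eps 1 \<le> (2 + b) * (3 * k * tau A eps 1)"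
        using b2 \<sigma>0 k1 \<tau>0[OF l1] by (intro mult_mono) auto
      also have "\<dots> \<le> \<delta>v (tau A eps 1)" using \<delta>t_ge(1)[of "tau A eps 1"] \<delta>tv[of "tau A eps 1"] \<tau>0[OF l1] by simp
      finally show "(2 + \<sigma>) * (sqrt (cond_num (A 1)) * eps 1) \<le> \<delta>v (tau A eps 1)" by (simp add: tau_def)
    qed simp
    finally show ?case unfolding coarsest(4,7) by (simp add: V_def)
  next
    case (finer j r e0 r0 e1 y_half e2 s e3 rc dc e4 d e5 y)
    have j: "j \<in> {2..l}" using finer.hyps(1) finer.prems by simp
    note j1 = coarse(1)[OF j] and j2 = coarse(2)[OF j]
    have dj: "dim_row (A j) = n j" using A_carrier[OF j2] by simp
    have dcc: "dc \<in> carrier_vec (n (j - 1))"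
      using rounded_cycle_carrier[OF finer.hyps(13)] A_carrier[OF j1] by simp
    have e: "0 < eps j" "eps j < 1" "0 < eps (j - 1)" "eps (j - 1) < 1"
      using eps_range[OF j1] eps_range[OF j2] by auto
    let ?Q = "transpose_mat (P j) * P j" and ?\<tau> = "tau A eps j"
    let ?N = "energy_norm (A j) (inv_mat (A j) *\<^sub>v r)"
    have \<tau>j: "0 < ?\<tau>" by (rule \<tau>0[OF j2])
    have q: "sqrt (cond_num ?Q) * sqrt (cond_num (A j)) \<le> sqrt \<kappa>P * sqrt (cond_num (A j))"
      using \<kappa>P1[OF j] \<kappa>1[OF j2] by (intro mult_right_mono) auto
    have c_bound: "c * sqrt (cond_num ?Q) * sqrt (cond_num (A j)) \<le> a * k * ?\<tau>"
      if "0 \<le> c" "c \<le> a * (\<zeta> * mPp * eps j)" for a c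
    proof -
      have "c * (sqrt (cond_num ?Q) * sqrt (cond_num (A j)))
          \<le> a * (\<zeta> * mPp * eps j) * (sqrt \<kappa>P * sqrt (cond_num (A j)))"
        using that q \<kappa>P1[OF j] \<kappa>1[OF j2] by (intro mult_mono) auto
      then show ?thesis by (simp add: k_def tau_def mult_ac)
    qed
    have p: "1 * eps j \<le> \<zeta> * eps j" "1 * (\<zeta> * eps j) \<le> mPp * (\<zeta> * eps j)" "mPp * eps (j - 1) \<le> mPp * (\<zeta> * eps j)"
      using \<zeta>1 mPp1 e \<zeta>j[OF j] by (intro mult_right_mono mult_left_mono; simp)+
    \<comment> \<open>Origin of the 3 in \<open>mu\<close>: the bare coarse roundoff counts once,
      and 1 + \<open>eps (j - 1)\<close> is at most 2. Interpolation needs the unit only once, which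
      gives its coefficient \<mu> / 3.\<close>
    have c3: "eps (j - 1) + (1 + eps (j - 1)) * mPp * eps j \<le> 3 * (\<zeta> * mPp * eps j)"
    proof -
      have "(1 + eps (j - 1)) * (mPp * eps j) \<le> 2 * (mPp * (\<zeta> * eps j))"
        using e mPp1 p(1) by (intro mult_mono mult_left_mono) auto
      then show ?thesis using p \<zeta>j[OF j] by (simp add: mult_ac)
    qed
    have "energy_norm (A j) (y - (inv_mat (A j) *\<^sub>v r - V j *\<^sub>v (inv_mat (A j) *\<^sub>v r)))
      \<le> (\<delta>v (tau A eps (j - 1)) + (4 * ?\<tau> + (2 + beta \<sigma> mAp) * (3 * k * ?\<tau>) + 2 * ?\<tau>\<^sup>2
          + (4 + beta \<sigma> mAp) * (3 * k * ?\<tau>) * ?\<tau> + 2 * (3 * k * ?\<tau>) * ?\<tau>\<^sup>2)) * ?N"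
    proof (rule two_level_error[OF A_carrier[OF j2] A_spd[OF j2] dims[OF j2] M_carrier[OF j2] e(1,2) sig[OF j2]
          finer.hyps(2)[unfolded dj] finer.hyps(3)[unfolded dj] finer.hyps(4)
          finer.hyps(6)[unfolded dj] finer.hyps(7)[unfolded finer.hyps(5)]
          P_carrier[OF j] dims[OF j1] galerkin[OF j] A_spd[OF j1] G_eq[OF j2] G_le[OF j2] Vc[OF j1] V_le[OF j1]
          Vc[OF j2] V_le[OF j2]])
      show "V j *\<^sub>v v = relax_err A M j *\<^sub>v v - P j *\<^sub>v (w - V (j - 1) *\<^sub>v w)"
        if "v \<in> carrier_vec (n j)"
          "w = inv_mat (A (j - 1)) *\<^sub>v (transpose_mat (P j) *\<^sub>v (A j *\<^sub>v (relax_err A M j *\<^sub>v v)))" for v w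
        unfolding V_def
        by (rule vcycle_err_mult_vec[OF A_carrier[OF j2] P_carrier[OF j] M_carrier[OF j2] Vc[OF j1, unfolded V_def]
              spd_inv_mat(1)[OF A_carrier[OF j1] A_spd[OF j1] A_carrier[OF j1]] finer.hyps(1) that])
      show "0 \<le> \<rho>_star" by (rule rho_range(1))
      show "0 \<le> \<delta>v (tau A eps (j - 1))"
        using \<delta>tv[of "tau A eps (j - 1)"] \<delta>t_ge(2)[of "tau A eps (j - 1)"] \<tau>0[OF j1] by simp
      show "\<rho>_star + \<delta>v (tau A eps (j - 1)) \<le> 1" by (rule small[OF j1])
      show "0 \<le> mAp" by (rule mAp0)
      show "y_half = M j *\<^sub>v (r + e0) + e1" using finer.hyps(8) finer.hyps(5) by simp
      show "abs_vec e2 \<le> (mAp * eps j) \<cdot>\<^sub>v (abs_vec (r + e0) + abs_mat (A j) *\<^sub>v abs_vec y_half)"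
        using finer.hyps(9) finer.hyps(5) by simp
      show "s = A j *\<^sub>v y_half - (r + e0) + e2" using finer.hyps(10) finer.hyps(5) by simp
      show "0 \<le> eps (j - 1) + (1 + eps (j - 1)) * mPp * eps j" using e mPp1 by simp
      show "abs_vec e3 \<le> (eps (j - 1) + (1 + eps (j - 1)) * mPp * eps j) \<cdot>\<^sub>v (transpose_mat (P j) *\<^sub>v abs_vec s)"
        by (rule finer.hyps(11))
      show "rc = transpose_mat (P j) *\<^sub>v s + e3" by (rule finer.hyps)
      show "dc \<in> carrier_vec (n (j - 1))" by (rule dcc)
      show "energy_norm (A (j - 1)) (dc - (inv_mat (A (j - 1)) *\<^sub>v rc - V (j - 1) *\<^sub>v (inv_mat (A (j - 1)) *\<^sub>v rc)))
          \<le> \<delta>v (tau A eps (j - 1)) * energy_norm (A (j - 1)) (inv_mat (A (j - 1)) *\<^sub>v rc)"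
        using finer.IH finer.prems by simp
      show "0 \<le> mPp * eps (j - 1)" using mPp1 e by simp
      show "abs_vec e4 \<le> (mPp * eps (j - 1)) \<cdot>\<^sub>v (P j *\<^sub>v abs_vec dc)" by (rule finer.hyps)
      show "d = P j *\<^sub>v dc + e4" by (rule finer.hyps)
      show "\<forall>i<n j. \<bar>e5 $ i\<bar> \<le> eps j" using finer.hyps by (simp add: dj)
      show "y = vec (n j) (\<lambda>i. (y_half $ i - d $ i) * (1 + e5 $ i))" using finer.hyps by (simp add: dj)
      show "(eps (j - 1) + (1 + eps (j - 1)) * mPp * eps j) * sqrt (cond_num ?Q) * sqrt (cond_num (A j)) \<le> 3 * k * ?\<tau>"
        using c3 e mPp1 by (intro c_bound) auto
      show "mPp * eps (j - 1) * sqrt (cond_num ?Q) * sqrt (cond_num (A j)) \<le> 3 * k * ?\<tau> / 3"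
        using c_bound[of "mPp * eps (j - 1)" 1] p(3) e mPp1 by (simp add: mult_ac)
      show "?\<tau> = sqrt (cond_num (A j)) * eps j" by (simp add: tau_def)
      show "3 * ?\<tau> \<le> 3 * k * ?\<tau>" using k1 \<tau>j by simp
      show "3 * k * ?\<tau> * (2 + beta \<sigma> mAp) \<le> 1"
        using \<delta>t_ge(1)[of ?\<tau>] \<delta>tv[of ?\<tau>] \<tau>j small[OF j2] rho_range(1) by (simp add: b_def mult_ac)
    qed
    also have "\<dots> = (\<delta>v (tau A eps (j - 1)) + \<delta>t ?\<tau>) * ?N" by (simp only: \<delta>t_eq b_def)
    also have "\<dots> \<le> \<delta>v ?\<tau> * ?N" using \<delta>v_step[OF j] by (intro mult_right_mono) auto
    finally show ?case .
  qed

  have l: "l \<in> {1..l}" using levels by simp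
  define x where "x = inv_mat (A l) *\<^sub>v r"
  have x: "x \<in> carrier_vec (n l)"
    using spd_inv_mat_mult_vec(3)[OF A_spd[OF l] A_carrier[OF l] r_carrier] by (simp add: x_def)
  have yc: "y \<in> carrier_vec (n l)" using rounded_cycle_carrier[OF cycle] A_carrier[OF l] by simp
  have Vx: "V l *\<^sub>v x \<in> carrier_vec (n l)" using Vc[OF l] x by simp
  have "y - x = (y - (x - V l *\<^sub>v x)) - V l *\<^sub>v x" using yc x Vx Vc[OF l] by (intro eq_vecI) auto
  also have "energy_norm (A l) \<dots> \<le> energy_norm (A l) (y - (x - V l *\<^sub>v x)) + energy_norm (A l) (V l *\<^sub>v x)"
    using yc x Vx by (intro energy_norm_triangle_minus[OF A_carrier[OF l] A_spd[OF l]]) auto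
  also have "\<dots> \<le> \<delta>v (tau A eps l) * energy_norm (A l) x + \<rho>_star * energy_norm (A l) x"
    using main[OF cycle[folded mAp_def mPp_def]] V_le[OF l x] by (intro add_mono) (auto simp: x_def)
  finally show ?thesis by (simp add: x_def \<delta>v_def algebra_simps)
qed

end
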